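(* Let $n\geq 1$ and let $(s_1,\ldots,s_n)$ be a tuple of reflections in $\mathrm{GL}(\mathbb{R}^n)$ which have an associated Cartan matrix that is symmetric and invertible; that is, for each $i$ one can choose a root $r_i\in\mathbb{R}^n$ and a corresponding coroot $\check r_i\in(\mathbb{R}^n)^*$ of $s_i$ such that the matrix $C=(\check r_i(r_j))_{1\le i,j\le n}$ is symmetric and invertible. Assume in addition that the orbit of $(s_1,\ldots,s_n)$ under the Hurwitz action of the $n$-strand braid group $B_n$ on $\mathrm{GL}(\mathbb{R}^n)^n$ is finite. Then the subgroup of $\mathrm{GL}(\mathbb{R}^n)$ generated by $s_1,\ldots,s_n$ is finite.
   Context: **Reflections, roots, coroots.** Let $V$ be a finite-dimensional vector space over a subfield $K$ of $\mathbb{C}$ (here $K=\mathbb{R}$, $V=\mathbb{R}^n$). A (complex) reflection is a finite order element $s\in\mathrm{GL}(V)$ whose fixed points form a hyperplane. If $\zeta$ (a root of unity) is the unique non-trivial eigenvalue of $s$, then $s$ can be written $s(x)=x-\check r(x)\,r$ where $r\in V$ and $\check r\in V^*$ satisfy $\check r(r)=1-\zeta$. The pair $(r,\check r)$ is unique up to multiplying $r$ by a nonzero scalar and $\check r$ by the inverse scalar; $r$ is called a root and $\check r$ a (corresponding) coroot associated to $s$. (Over $K=\mathbb{R}$ one has $\zeta=-1$, so $s$ has order $2$ and $\check r(r)=2$.) **Cartan matrix.** If $(s_1,\ldots,s_n)$ is a tuple of reflections with corresponding roots $r_i$ and coroots $\check r_i$, the matrix $C=(\check r_i(r_j))_{i,j}$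 is called a Cartan matrix of the tuple. It is unique up to conjugation by an invertible diagonal matrix. **Hurwitz action.** For a group $G$, the Hurwitz action is the action of the $n$-strand braid group $B_n$, with standard generators $\sigma_1,\ldots,\sigma_{n-1}$, on $G^n$ given by $$\sigma_i(s_1,\ldots,s_n)=(s_1,\ldots,s_{i-1},\,s_{i+1},\,s_{i+1}^{-1}s_is_{i+1},\,s_{i+2},\ldots,s_n).$$ *)

theory Defs
  imports
    "HOL-Analysis.Analysis"
    "HOL-Algebra.Generated_Groups"
    "HOL-Algebra.Group_Action"
    "Jordan_Normal_Form.Matrix"
begin

section \<open>Reflections, roots, coroots, Cartan matrices\<close>

definition GL :: "('a::euclidean_space \<Rightarrow> 'a) monoid" where
  "GL = \<lparr>carrier = {f. linear f \<and> bij f}, mult = (\<circ>), one = id\<rparr>"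

lemma group_GL: "group (GL :: ('a::euclidean_space \<Rightarrow> 'a) monoid)"
proof (rule groupI)
  fix f :: "'a \<Rightarrow> 'a" assume "f \<in> carrier GL"
  then have f: "linear f" "bij f"
    by (simp_all add: GL_def)
  then have "linear (inv_into UNIV f)"
    by (simp add: bij_is_inj inj_linear_imp_inv_linear)
  with f have "inv_into UNIV f \<in> carrier GL" "inv_into UNIV f \<otimes>\<^bsub>GL\<^esub> f = \<one>\<^bsub>GL\<^esub>"
    by (simp_all add: GL_def bij_imp_bij_inv bij_is_inj)
  then show "\<exists>g\<in>carrier GL. g \<otimes>\<^bsub>GL\<^esub> f = \<one>\<^bsub>GL\<^esub>"
    by blast
qed (auto simp: GL_def linear_compose bij_comp linear_id comp_assoc)

definition reflection :: "('a::euclidean_space \<Rightarrow> 'a) \<Rightarrow> bool" where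
  "reflection s \<longleftrightarrow>
     s \<in> carrier GL \<and>
     (\<exists>k::nat. 0 < k \<and> s [^]\<^bsub>GL\<^esub> k = \<one>\<^bsub>GL\<^esub>) \<and>
     dim {x. s x = x} + 1 = DIM('a)"

definition root_coroot ::
    "('a::euclidean_space \<Rightarrow> 'a) \<Rightarrow> 'a \<Rightarrow> ('a \<Rightarrow> real) \<Rightarrow> bool" where
  "root_coroot s r rv \<longleftrightarrow>
     linear rv \<and> (\<forall>x. s x = x - rv x *\<^sub>R r) \<and>
     (\<exists>\<zeta>::real. \<zeta> \<noteq> 1 \<and> (\<exists>v. v \<noteq> 0 \<and> s v = \<zeta> *\<^sub>R v) \<and> rv r = 1 - \<zeta>)"

text \<open>Tuples are lists, so all indices start at 0.\<close>

definition cartan_matrix ::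
    "('a::euclidean_space \<Rightarrow> 'a) list \<Rightarrow> real Matrix.mat \<Rightarrow> bool" where
  "cartan_matrix s C \<longleftrightarrow>
     (\<exists>r rv. length r = length s \<and> length rv = length s \<and>
        (\<forall>i<length s. root_coroot (s ! i) (r ! i) (rv ! i)) \<and>
        C = Matrix.mat (length s) (length s) (\<lambda>(i, j). (rv ! i) (r ! j)))"

section \<open>The braid group\<close>

text \<open>The pair \<open>(i, True)\<close> stands for the generator \<open>\<sigma>\<^sub>i\<close>, where \<open>1 \<le> i < n\<close>, and
  \<open>(i, False)\<close> for its inverse.\<close>

definition braid_words :: "nat \<Rightarrow> (nat \<times> bool) list set" where
  "braid_words n = lists ({1..<n} \<times> UNIV)"

inductive braid_eq :: "nat \<Rightarrow> (nat \<times> bool) list \<Rightarrow> (nat \<times> bool) list \<Rightarrow> bool"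
  for n :: nat where
  refl: "w \<in> braid_words n \<Longrightarrow> braid_eq n w w"
| sym: "braid_eq n v w \<Longrightarrow> braid_eq n w v"
| trans: "braid_eq n u v \<Longrightarrow> braid_eq n v w \<Longrightarrow> braid_eq n u w"
| append: "braid_eq n u u' \<Longrightarrow> braid_eq n v v' \<Longrightarrow> braid_eq n (u @ v) (u' @ v')"
| cancel: "1 \<le> i \<Longrightarrow> i < n \<Longrightarrow> braid_eq n [(i, b), (i, \<not> b)] []"
| commute: "1 \<le> i \<Longrightarrow> i + 2 \<le> j \<Longrightarrow> j < n \<Longrightarrow>
    braid_eq n [(i, True), (j, True)] [(j, True), (i, True)]"
| braid: "1 \<le> i \<Longrightarrow> i + 1 < n \<Longrightarrow>
    braid_eq n [(i, True), (i + 1, True), (i, True)]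
               [(i + 1, True), (i, True), (i + 1, True)]"

definition braid_group :: "nat \<Rightarrow> (nat \<times> bool) list set monoid" where
  "braid_group n =
     \<lparr>carrier = braid_words n // {(v, w). braid_eq n v w},
      mult = (\<lambda>A B. \<Union>a\<in>A. \<Union>b\<in>B. {w. braid_eq n (a @ b) w}),
      one = {w. braid_eq n [] w}\<rparr>"

abbreviation braid_class :: "nat \<Rightarrow> (nat \<times> bool) list \<Rightarrow> (nat \<times> bool) list set" where
  "braid_class n v \<equiv> {w. braid_eq n v w}"

lemma braid_eq_words: "braid_eq n v w \<Longrightarrow> v \<in> braid_words n \<and> w \<in> braid_words n"
  by (induction rule: braid_eq.induct) (auto simp: braid_words_def)

lemma braid_class_eq_iff:
  "v \<in> braid_words n \<Longrightarrow> braid_class n v = braid_class n w \<longleftrightarrow> braid_eq n v w"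
  by (auto intro: braid_eq.intros)

lemma carrier_braid_group: "carrier (braid_group n) = braid_class n ` braid_words n"
  by (auto simp: braid_group_def quotient_def)

lemma one_braid_group: "\<one>\<^bsub>braid_group n\<^esub> = braid_class n []"
  by (simp add: braid_group_def)

lemma mult_braid_class:
  assumes "v \<in> braid_words n" "w \<in> braid_words n"
  shows "braid_class n v \<otimes>\<^bsub>braid_group n\<^esub> braid_class n w = braid_class n (v @ w)"
proof -
  have "braid_eq n v v" "braid_eq n w w"
    using assms by (auto intro: braid_eq.refl)
  then show ?thesis
    unfolding braid_group_def by (auto intro: braid_eq.append braid_eq.trans)
qed

definition word_inv :: "(nat \<times> bool) list \<Rightarrow> (nat \<times> bool) list" where
  "word_inv w = rev (map (\<lambda>(i, b). (i, \<not> b)) w)"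

lemma word_inv_words: "w \<in> braid_words n \<Longrightarrow> word_inv w \<in> braid_words n"
  by (fastforce simp: word_inv_def braid_words_def)

lemma word_inv_left: "w \<in> braid_words n \<Longrightarrow> braid_eq n (word_inv w @ w) []"
proof (induction w)
  case Nil
  then show ?case by (simp add: word_inv_def braid_eq.refl)
next
  case (Cons x w)
  obtain i b where x: "x = (i, b)" by (cases x)
  have i: "1 \<le> i" "i < n" and w: "w \<in> braid_words n"
    using Cons.prems by (auto simp: x braid_words_def)
  have "braid_eq n [(i, \<not> b), (i, b)] []"
    using braid_eq.cancel[OF i, of "\<not> b"] by simp
  then have "braid_eq n (word_inv w @ ([(i, \<not> b), (i, b)] @ w)) (word_inv w @ ([] @ w))"
    using w by (intro braid_eq.append braid_eq.refl word_inv_words)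
  with Cons.IH[OF w] show ?case
    by (auto simp: word_inv_def x intro: braid_eq.trans)
qed

lemma braid_words_append:
  "v \<in> braid_words n \<Longrightarrow> w \<in> braid_words n \<Longrightarrow> v @ w \<in> braid_words n"
  by (simp add: braid_words_def)

lemma Nil_braid_words: "[] \<in> braid_words n"
  by (simp add: braid_words_def)

lemma group_braid_group: "group (braid_group n)"
proof (rule groupI)
  fix A assume "A \<in> carrier (braid_group n)"
  then obtain v where v: "v \<in> braid_words n" "A = braid_class n v"
    by (auto simp: carrier_braid_group)
  then have "braid_class n (word_inv v) \<otimes>\<^bsub>braid_group n\<^esub> A = \<one>\<^bsub>braid_group n\<^esub>"
    by (simp add: mult_braid_class one_braid_group word_inv_words word_inv_left
        braid_class_eq_iff braid_words_append)
  with v show "\<exists>B\<in>carrier (braid_group n). B \<otimes>\<^bsub>braid_group n\<^esub> A = \<one>\<^bsub>braid_group n\<^esub>"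
    by (auto simp: carrier_braid_group word_inv_words)
qed (auto simp: carrier_braid_group one_braid_group mult_braid_class braid_words_append
    Nil_braid_words)

section \<open>The Hurwitz action\<close>

definition tuples :: "('a, 'm) monoid_scheme \<Rightarrow> nat \<Rightarrow> 'a list set" where
  "tuples G n = {s. length s = n \<and> set s \<subseteq> carrier G}"

text \<open>The generator \<open>\<sigma>\<^sub>i\<close> changes the entries with 1-based indices \<open>i\<close> and \<open>i + 1\<close>, that
  is, the list positions \<open>i - 1\<close> and \<open>i\<close>.\<close>

fun hurwitz_gen :: "('a, 'm) monoid_scheme \<Rightarrow> nat \<times> bool \<Rightarrow> 'a list \<Rightarrow> 'a list" where
  "hurwitz_gen G (i, True) s =
     s[i - 1 := s ! i, i := inv\<^bsub>G\<^esub> (s ! i) \<otimes>\<^bsub>G\<^esub> s ! (i - 1) \<otimes>\<^bsub>G\<^esub> s ! i]"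
| "hurwitz_gen G (i, False) s =
     s[i - 1 := s ! (i - 1) \<otimes>\<^bsub>G\<^esub> s ! i \<otimes>\<^bsub>G\<^esub> inv\<^bsub>G\<^esub> (s ! (i - 1)), i := s ! (i - 1)]"

definition hurwitz_word ::
    "('a, 'm) monoid_scheme \<Rightarrow> (nat \<times> bool) list \<Rightarrow> 'a list \<Rightarrow> 'a list" where
  "hurwitz_word G w = foldr (hurwitz_gen G) w"

definition hurwitz_action ::
    "('a, 'm) monoid_scheme \<Rightarrow> nat \<Rightarrow> (nat \<times> bool) list set \<Rightarrow> 'a list \<Rightarrow> 'a list" where
  "hurwitz_action G n A = (\<lambda>s\<in>tuples G n. hurwitz_word G (SOME w. w \<in> A) s)"

context group
begin

lemma hurwitz_gen_tuples:
  assumes "1 \<le> i" "i < n" "s \<in> tuples G n"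
  shows "hurwitz_gen G (i, b) s \<in> tuples G n"
proof -
  have "s ! k \<in> carrier G" if "k < n" for k
    using assms that by (auto simp: tuples_def)
  with assms show ?thesis
    by (cases b) (auto simp: tuples_def dest!: set_update_subset_insert[THEN subsetD])
qed

lemma hurwitz_word_tuples:
  "w \<in> braid_words n \<Longrightarrow> s \<in> tuples G n \<Longrightarrow> hurwitz_word G w s \<in> tuples G n"
  by (induction w) (auto simp: braid_words_def hurwitz_word_def hurwitz_gen_tuples)

lemma inv_cancel:
  assumes "x \<in> carrier G" "y \<in> carrier G"
  shows "inv x \<otimes> (x \<otimes> y) = y" "x \<otimes> (inv x \<otimes> y) = y"
  using assms by (simp_all flip: m_assoc)

lemma hurwitz_word_cong:
  assumes "braid_eq n v w" "s \<in> tuples G n"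
  shows "hurwitz_word G v s = hurwitz_word G w s"
  using assms
proof (induction arbitrary: s rule: braid_eq.induct)
  case (append u u' v v')
  then show ?case
    by (metis braid_eq_words comp_apply foldr_append hurwitz_word_def hurwitz_word_tuples)
next
  case (cancel i b)
  have c: "s ! k \<in> carrier G" if "k < n" for k
    using cancel that by (auto simp: tuples_def)
  have "s ! i \<in> carrier G" "s ! (i - 1) \<in> carrier G" "i - 1 < length s" "i < length s"
    using cancel by (auto intro: c simp: tuples_def)
  with cancel(1) show ?case
    by (cases b)
      (auto simp: hurwitz_word_def m_assoc inv_cancel nth_list_update intro!: nth_equalityI)
next
  case (commute i j)
  then show ?case
    by (auto simp: hurwitz_word_def tuples_def nth_list_update intro!: nth_equalityI)
next
  case (braid i)
  have c: "s ! k \<in> carrier G" if "k < n" for k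
    using braid that by (auto simp: tuples_def)
  have "s ! Suc i \<in> carrier G" "s ! i \<in> carrier G" "s ! (i - 1) \<in> carrier G"
    "i - 1 < length s" "i < length s" "Suc i < length s"
    using braid by (auto intro: c simp: tuples_def)
  with braid(1) show ?case
    by (auto simp: hurwitz_word_def nth_list_update m_assoc inv_cancel inv_mult_group
        intro!: nth_equalityI)
qed (auto simp: hurwitz_word_def)

lemma hurwitz_action_class:
  assumes "w \<in> braid_words n"
  shows "hurwitz_action G n (braid_class n w) = (\<lambda>s\<in>tuples G n. hurwitz_word G w s)"
proof -
  have "braid_eq n w (SOME v. v \<in> braid_class n w)"
    using someI[of "\<lambda>v. v \<in> braid_class n w" w] assms by (auto intro: braid_eq.refl)
  then show ?thesis
    unfolding hurwitz_action_def by (auto simp: hurwitz_word_cong intro!: restrict_ext)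
qed

lemma group_action_hurwitz:
  "group_action (braid_group n) (tuples G n) (hurwitz_action G n)"
proof -
  let ?E = "tuples G n" and ?h = "hurwitz_word G"
  have word_append: "?h (v @ w) s = ?h v (?h w s)" for v w and s :: "'a list"
    by (simp add: hurwitz_word_def)
  have bij: "(\<lambda>s\<in>?E. ?h w s) \<in> Bij ?E" if w: "w \<in> braid_words n" for w
  proof -
    have inv_inv: "word_inv (word_inv w) = w"
      by (simp add: word_inv_def rev_map o_def case_prod_unfold)
    have "?h (word_inv w) (?h w s) = s" "?h w (?h (word_inv w) s) = s" if "s \<in> ?E" for s
      using hurwitz_word_cong[OF word_inv_left[OF w] that]
        hurwitz_word_cong[OF word_inv_left[OF word_inv_words[OF w]] that]
      by (simp_all only: inv_inv word_append) (simp_all add: hurwitz_word_def)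
    then have "bij_betw (?h w) ?E ?E"
      by (intro bij_betw_byWitness[where f' = "?h (word_inv w)"])
        (auto simp: hurwitz_word_tuples w word_inv_words)
    then show ?thesis
      by (simp add: Bij_def cong: bij_betw_cong)
  qed
  have "hurwitz_action G n \<in> hom (braid_group n) (BijGroup ?E)"
  proof (rule homI)
    fix A assume "A \<in> carrier (braid_group n)"
    then show "hurwitz_action G n A \<in> carrier (BijGroup ?E)"
      by (auto simp: carrier_braid_group hurwitz_action_class BijGroup_def bij)
  next
    fix A B assume "A \<in> carrier (braid_group n)" "B \<in> carrier (braid_group n)"
    then obtain v w where "v \<in> braid_words n" "A = braid_class n v"
      "w \<in> braid_words n" "B = braid_class n w"
      by (auto simp: carrier_braid_group)
    then show "hurwitz_action G n (A \<otimes>\<^bsub>braid_group n\<^esub> B) =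
        hurwitz_action G n A \<otimes>\<^bsub>BijGroup ?E\<^esub> hurwitz_action G n B"
      by (auto simp: mult_braid_class hurwitz_action_class braid_words_append BijGroup_def
          bij compose_def word_append hurwitz_word_tuples intro!: restrict_ext)
  qed
  then show ?thesis
    by (intro group_action.intro group_hom.intro group_hom_axioms.intro
        group_braid_group group_BijGroup)
qed

end

end

theory Submission
  imports Defs "Jordan_Normal_Form.Char_Poly" "HOL-Library.Sublist"
begin

text \<open>The Cartan matrix \<open>C\<close> is symmetric with diagonal entries \<open>2\<close> and invertible, so the roots form a
basis and everything can be computed in their coordinates, where \<open>s\<^sub>i\<close> maps \<open>r\<^sub>j\<close> to
\<open>r\<^sub>j - C\<^sub>i\<^sub>j r\<^sub>i\<close>. The group preserves the symmetric form with Gram matrix \<open>C\<close>. It is finite because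
the numbers \<open>\<langle>r\<^sub>i, g r\<^sub>j\<rangle>\<close>, which determine \<open>g\<close>, are algebraic integers of one cyclotomic field that
are bounded together with all their conjugates. The argument has four steps.

\<^item> A subtuple can be moved to the front of its tuple by Hurwitz moves, and its cyclic rotations then
  conjugate it by its product \<open>c\<close>. As the orbit is finite, a power of \<open>c\<close> commutes with every
  reflection of the subtuple (\<open>subtuple_prod_pow_commutes\<close>). Because \<open>c\<close> preserves the form, \<open>c\<close>
  has finite order on the span of the corresponding roots (\<open>finite_order\<close>).

\<^item> This forces the form to be positive semidefinite (\<open>positive_semidefinite\<close>). Otherwise take a
  minimal set of roots whose span contains a vector of negative norm. On this span the form has only
  one negative direction, and each reflection preserves both halves of the cone of negative vectors
  because its root has positive norm. Adding up the orbit of a negative vector under the finite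
  order element \<open>c\<close> gives a negative vector fixed by \<open>c\<close>. But a vector fixed by a product of
  reflections in independent roots is orthogonal to all of them. Semidefiniteness bounds
  \<open>\<bar>\<langle>r\<^sub>i, g r\<^sub>j\<rangle>\<bar>\<close> by \<open>2\<close>.

\<^item> Applied to a pair of reflections, finite order shows that each entry of \<open>C\<close> is \<open>y + 1/y\<close> for
  a root of unity \<open>y\<close> (\<open>entry_root_of_unity\<close>). Hence \<open>C\<close> is the value at a root of unity \<open>z\<close>
  of a matrix \<open>P\<close> over \<open>\<int>[X]\<close>, and each \<open>\<langle>r\<^sub>i, g r\<^sub>j\<rangle>\<close> is the value at \<open>z\<close> of an integer polynomial.

\<^item> The value of \<open>P\<close> at a conjugate of \<open>z\<close> is again a real symmetric matrix, and the relations
  saying that powers of partial products commute with the reflections are polynomial identities, so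
  they hold for it too. The second step applies to each conjugate, which gives the bound \<open>2\<close> for all
  conjugates of \<open>\<langle>r\<^sub>i, g r\<^sub>j\<rangle>\<close>, and only finitely many elements of \<open>\<int>[z]\<close> satisfy such bounds
  (\<open>finite_bounded_conjugates\<close>).\<close>

section \<open>Reflections in the coordinates of the roots\<close>

text \<open>The reflection of index \<open>i\<close> in the basis of roots. The ring is arbitrary because the same word in the
reflections is evaluated over \<open>\<int>[X]\<close>, over \<open>\<real>\<close> and over \<open>\<complex>\<close>.\<close>

definition coord_refl :: "nat \<Rightarrow> (nat \<Rightarrow> nat \<Rightarrow> 'a::comm_ring_1) \<Rightarrow> nat \<Rightarrow> (nat \<Rightarrow> 'a) \<Rightarrow> nat \<Rightarrow> 'a" where
  "coord_refl n A i x = x(i := x i - (\<Sum>j<n. A i j * x j))"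

definition act :: "nat \<Rightarrow> (nat \<Rightarrow> nat \<Rightarrow> 'a::comm_ring_1) \<Rightarrow> nat list \<Rightarrow> (nat \<Rightarrow> 'a) \<Rightarrow> nat \<Rightarrow> 'a" where
  "act n A w = foldr (coord_refl n A) w"

definition unitv :: "nat \<Rightarrow> nat \<Rightarrow> 'a::comm_ring_1" where
  "unitv i = (\<lambda>k. if k = i then 1 else 0)"

definition bil :: "nat \<Rightarrow> (nat \<Rightarrow> nat \<Rightarrow> 'a::comm_ring_1) \<Rightarrow> (nat \<Rightarrow> 'a) \<Rightarrow> (nat \<Rightarrow> 'a) \<Rightarrow> 'a" where
  "bil n A x y = (\<Sum>i<n. x i * (\<Sum>j<n. A i j * y j))"

lemma act_Nil [simp]: "act n A [] x = x"
  and act_Cons [simp]: "act n A (i # w) x = coord_refl n A i (act n A w x)"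
  and act_append: "act n A (v @ w) x = act n A v (act n A w x)"
  by (simp_all add: act_def)

lemma bil_unitv: "i < n \<Longrightarrow> bil n A (unitv i) y = (\<Sum>j<n. A i j * y j)"
  by (simp add: bil_def unitv_def if_distrib if_distribR cong: if_cong)

lemma bil_unitv_unitv: "i < n \<Longrightarrow> j < n \<Longrightarrow> bil n A (unitv i) (unitv j) = A i j"
  by (simp add: bil_unitv) (simp add: unitv_def if_distrib cong: if_cong)

lemma coord_refl_eq: "i < n \<Longrightarrow> coord_refl n A i x = (\<lambda>k. x k - bil n A (unitv i) x * unitv i k)"
  by (auto simp: coord_refl_def bil_unitv fun_eq_iff) (simp_all add: unitv_def)

lemma act_concat_replicate: "act n A (concat (replicate k w)) x = (act n A w ^^ k) x"
  by (induction k) (simp_all add: act_append)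

lemma bil_linear_right:
  "bil n A x (\<lambda>k. y k + z k) = bil n A x y + bil n A x z"
  "bil n A x (\<lambda>k. y k - z k) = bil n A x y - bil n A x z"
  "bil n A x (\<lambda>k. a * y k) = a * bil n A x y"
  "bil n A x (\<lambda>k. y k * a) = bil n A x y * a"
  "bil n A x (\<lambda>k. \<Sum>i\<in>S. f i k) = (\<Sum>i\<in>S. bil n A x (f i))"
  by (induction S rule: infinite_finite_induct)
    (simp_all add: bil_def algebra_simps sum.distrib sum_subtractf sum_distrib_left)

lemma bil_linear_left:
  "bil n A (\<lambda>k. y k + z k) x = bil n A y x + bil n A z x"
  "bil n A (\<lambda>k. y k - z k) x = bil n A y x - bil n A z x"
  "bil n A (\<lambda>k. a * y k) x = a * bil n A y x"
  "bil n A (\<lambda>k. y k * a) x = bil n A y x * a"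
  "bil n A (\<lambda>k. \<Sum>i\<in>S. f i k) x = (\<Sum>i\<in>S. bil n A (f i) x)"
  by (induction S rule: infinite_finite_induct)
    (simp_all add: bil_def algebra_simps sum.distrib sum_subtractf sum_distrib_left)

lemma bil_sym:
  assumes "\<And>i j. i < n \<Longrightarrow> j < n \<Longrightarrow> A i j = A j i"
  shows "bil n A x y = bil n A y x"
proof -
  have "bil n A x y = (\<Sum>j<n. \<Sum>i<n. x i * (A i j * y j))"
    unfolding bil_def sum_distrib_left by (rule sum.swap)
  also have "\<dots> = bil n A y x"
    unfolding bil_def sum_distrib_left
    by (intro sum.cong HOL.refl) (simp add: assms algebra_simps)
  finally show ?thesis .
qed

lemma coord_refl_sum: "coord_refl n A i (\<lambda>k. \<Sum>j\<in>S. a j * f j k) = (\<lambda>k. \<Sum>j\<in>S. a j * coord_refl n A i (f j) k)"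
proof -
  have "(\<Sum>j<n. A i j * (\<Sum>l\<in>S. a l * f l j)) = (\<Sum>l\<in>S. a l * (\<Sum>j<n. A i j * f l j))"
    unfolding sum_distrib_left by (subst sum.swap) (intro sum.cong HOL.refl, simp add: algebra_simps)
  then show ?thesis
    by (auto simp: coord_refl_def fun_eq_iff sum_subtractf algebra_simps)
qed

lemma act_sum: "act n A w (\<lambda>k. \<Sum>j\<in>S. a j * f j k) = (\<lambda>k. \<Sum>j\<in>S. a j * act n A w (f j) k)"
  by (induction w) (simp_all add: coord_refl_sum)

lemma act_scale: "act n A w (\<lambda>k. a * f k) = (\<lambda>k. a * act n A w f k)"
  using act_sum[of n A w "\<lambda>_. a" "\<lambda>_. f" "{0::nat}"] by simp

lemma act_outside: "k \<notin> set w \<Longrightarrow> act n A w x k = x k"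
  by (induction w) (auto simp: coord_refl_def)

text \<open>Specialization of the entries commutes with the action of words: only subtraction, multiplication
and finite sums occur in it.\<close>

lemma act_hom:
  assumes h: "\<And>a b. h (a - b) = h a - h b" "\<And>a b. h (a * b) = h a * h b"
    "\<And>f. h (\<Sum>j<n. f j) = (\<Sum>j<n. h (f j))"
  shows "h (act n A w x k) = act n (\<lambda>i j. h (A i j)) w (\<lambda>k. h (x k)) k"
  by (induction w arbitrary: k) (auto simp: coord_refl_def h)

section \<open>Positivity of the invariant form\<close>

locale symmetric_cartan =
  fixes n :: nat and A :: "nat \<Rightarrow> nat \<Rightarrow> real"
  assumes sym: "\<And>i j. i < n \<Longrightarrow> j < n \<Longrightarrow> A i j = A j i"
    and diag: "\<And>i. i < n \<Longrightarrow> A i i = 2"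
begin

abbreviation B where "B \<equiv> bil n A"
abbreviation e :: "nat \<Rightarrow> nat \<Rightarrow> real" where "e \<equiv> unitv"

lemma B_sym: "B x y = B y x"
  by (rule bil_sym) (rule sym)

lemma B_e: "i < n \<Longrightarrow> B (e i) (e i) = 2"
  by (simp add: bil_unitv_unitv diag)

lemma refl_involution: "i < n \<Longrightarrow> coord_refl n A i (coord_refl n A i x) = x"
  by (simp add: coord_refl_eq bil_linear_right B_e)

lemma B_refl:
  assumes i: "i < n"
  shows "B (coord_refl n A i x) (coord_refl n A i y) = B x y"
  using B_sym[of x "e i"]
  by (simp add: coord_refl_eq i bil_linear_right bil_linear_left B_e algebra_simps)

lemma B_act: "set w \<subseteq> {..<n} \<Longrightarrow> B (act n A w x) (act n A w y) = B x y"
  by (induction w) (auto simp: B_refl)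

text \<open>A vector fixed by a product of reflections in independent roots is orthogonal to these roots. Here
independence comes for free: the letters are distinct, and the reflection of index \<open>j\<close> changes only
the coordinate \<open>j\<close>. So the first reflection must fix that coordinate on its own.\<close>

lemma fixed_by_distinct_product:
  assumes "distinct w" "set w \<subseteq> {..<n}" "act n A w v = v" "i \<in> set w"
  shows "B (e i) v = 0"
  using assms
proof (induction w)
  case (Cons j w)
  let ?y = "act n A w v"
  have j: "j < n" using Cons.prems by simp
  have "coord_refl n A j ?y = v" using Cons.prems by simp
  then have y: "?y = coord_refl n A j v" using refl_involution[OF j] by metis
  have "?y j = v j" using Cons.prems by (intro act_outside) simp
  then have "B (e j) v = 0" using j by (simp add: y coord_refl_eq) (simp add: unitv_def)
  moreover from this have "?y = v" using j by (simp add: y coord_refl_eq)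
  ultimately show ?case using Cons by auto
qed simp

text \<open>If \<open>c ^ m\<close> commutes with the reflection of index \<open>i\<close>, it preserves the \<open>(-1)\<close>-eigenspace spanned by
\<open>e i\<close>, and being an isometry it acts there by a sign. Hence the exponent \<open>2 * m\<close>.\<close>

lemma finite_order_on_span:
  assumes w: "set w \<subseteq> {..<n}" and i: "i < n"
    and comm: "act n A (concat (replicate m w) @ [i]) (e i) = act n A (i # concat (replicate m w)) (e i)"
  shows "act n A (concat (replicate (2 * m) w)) (e i) = e i"
proof -
  let ?W = "concat (replicate m w)"
  let ?y = "act n A ?W (e i)"
  have W: "set ?W \<subseteq> {..<n}" using w by auto
  have "coord_refl n A i (e i) = (\<lambda>k. - 1 * e i k)"
    using i by (simp add: coord_refl_eq B_e algebra_simps)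
  then have "act n A ?W (coord_refl n A i (e i)) = (\<lambda>k. - 1 * ?y k)" by (simp only: act_scale)
  then have "coord_refl n A i ?y = (\<lambda>k. - ?y k)" using comm by (simp add: act_append)
  then have "?y k = (B (e i) ?y / 2) * e i k" for k
    using i by (simp add: coord_refl_eq fun_eq_iff field_simps)
  then obtain l where l: "?y = (\<lambda>k. l * e i k)" by blast
  have "B ?y ?y = 2" using B_act[OF W] B_e[OF i] by simp
  then have ll: "l * l = 1" using i by (simp add: l bil_linear_left bil_linear_right B_e)
  have "act n A ?W ?y = (\<lambda>k. l * ?y k)" unfolding l[unfolded] by (simp add: act_scale l)
  then have "act n A ?W ?y = e i" by (simp add: l ll fun_eq_iff flip: mult.assoc)
  moreover have "concat (replicate (2 * m) w) = ?W @ ?W"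
    by (simp add: mult_2 replicate_add)
  ultimately show ?thesis by (simp add: act_append)
qed

end

text \<open>The trace that a finite Hurwitz orbit leaves in coordinates. Evaluated at \<open>e i\<close>, the condition
consists of polynomial identities between the entries of \<open>A\<close>, which carry over to conjugate matrices.\<close>

locale torsion_cartan = symmetric_cartan +
  assumes comm: "\<And>I. I \<subseteq> {..<n} \<Longrightarrow> \<exists>m>0. \<forall>i\<in>I.
    act n A (concat (replicate m (sorted_list_of_set I)) @ [i]) (e i) =
    act n A (i # concat (replicate m (sorted_list_of_set I))) (e i)"
begin

lemma finite_order:
  assumes "I \<subseteq> {..<n}"
  obtains M where "M > 0" "\<And>i. i \<in> I \<Longrightarrow>
    (act n A (sorted_list_of_set I) ^^ M) (e i) = e i"
proof -
  have [simp]: "finite I" using assms finite_subset by blast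
  obtain m where m: "m > 0" "\<forall>i\<in>I.
    act n A (concat (replicate m (sorted_list_of_set I)) @ [i]) (e i) =
    act n A (i # concat (replicate m (sorted_list_of_set I))) (e i)"
    using comm[OF assms] by blast
  show ?thesis
  proof (rule that[of "2 * m"])
    fix i assume "i \<in> I"
    then show "(act n A (sorted_list_of_set I) ^^ (2 * m)) (e i) = e i"
      unfolding act_concat_replicate[symmetric] using assms m
      by (intro finite_order_on_span) auto
  qed (use m in auto)
qed

text \<open>On the span of a minimal set \<open>I\<close> of roots on which the form takes negative values, two negative
vectors are never orthogonal, since some combination of them lies in the span of a smaller set. This
is the Lorentzian situation, obtained without diagonalizing the form, and the sign of \<open>B x u\<close> tells
the two halves of the cone apart.\<close>

lemma positive_semidefinite: "B x x \<ge> 0"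
proof (rule ccontr)
  assume x: "\<not> B x x \<ge> 0"
  define neg where "neg = (\<lambda>I x. I \<subseteq> {..<n} \<and> (\<forall>k. k \<notin> I \<longrightarrow> x k = 0) \<and> B x x < 0)"
  have "neg {..<n} (\<lambda>k. if k < n then x k else 0)"
    using x by (simp add: neg_def bil_def)
  then have "\<exists>I x. neg I x" by blast
  then obtain I where "\<exists>x. neg I x" and minI: "\<And>J y. neg J y \<Longrightarrow> card I \<le> card J"
    using ex_has_least_nat[of "\<lambda>I. \<exists>x. neg I x" _ card] by metis
  then obtain u where u: "neg I u" by blast
  have I: "I \<subseteq> {..<n}" and finI: "finite I"
    using u finite_subset by (auto simp: neg_def)
  have "I \<noteq> {}"
  proof
    assume "I = {}"
    then have "u = (\<lambda>k. 0)" using u by (auto simp: neg_def)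
    then show False using u by (simp add: neg_def bil_def)
  qed
  then obtain i0 where i0: "i0 \<in> I" by blast
  have B_combination: "B (\<lambda>k. a * x k + b * y k) (\<lambda>k. a * x k + b * y k) =
      a\<^sup>2 * B x x + 2 * (a * b * B x y) + b\<^sup>2 * B y y" for a b x y
    using B_sym[of x y]
    by (simp add: bil_linear_left bil_linear_right power2_eq_square algebra_simps)
  have nonorth: "B x y \<noteq> 0" if x: "neg I x" and y: "neg I y" for x y
  proof
    assume 0: "B x y = 0"
    define z where "z = (\<lambda>k. y i0 * x k + (- x i0) * y k)"
    have *: "x i0 \<noteq> 0"
    proof
      assume "x i0 = 0"
      then have "neg (I - {i0}) x" using x by (auto simp: neg_def)
      then show False using minI i0 finI by (metis card_Diff1_less leD)
    qed
    have "B z z = (y i0)\<^sup>2 * B x x + (x i0)\<^sup>2 * B y y"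
      unfolding z_def B_combination 0 by simp
    also have "\<dots> < 0"
      using * x y by (intro add_nonpos_neg mult_nonneg_nonpos mult_pos_neg) (auto simp: neg_def)
    finally have "neg (I - {i0}) z"
      using x y by (auto simp: neg_def z_def)
    then show False using minI i0 finI by (metis card_Diff1_less leD)
  qed
  have cone: "neg I (coord_refl n A i x) \<and> B (coord_refl n A i x) u < 0"
    if i: "i \<in> I" and x: "neg I x" and xu: "B x u < 0" for i x
  proof -
    let ?y = "coord_refl n A i x"
    have i': "i < n" using i I by auto
    have y: "neg I ?y" using x i i' by (auto simp: neg_def B_refl) (auto simp: coord_refl_def)
    have xy: "B x ?y < 0"
    proof -
      have "B x ?y = B x x - (B (e i) x)\<^sup>2"
        using B_sym[of x "e i"] i' by (simp add: coord_refl_eq bil_linear_right power2_eq_square)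
      then show ?thesis using x by (smt (verit) neg_def zero_le_power2)
    qed
    \<comment> \<open>The segment from \<open>x\<close> to its image stays in the cone, so it cannot cross the hyperplane
      orthogonal to \<open>u\<close>.\<close>
    have "\<not> B ?y u > 0"
    proof
      assume yu: "B ?y u > 0"
      define a b where "a = B ?y u" and "b = - B x u"
      have ab: "a > 0" "b > 0" using yu xu by (auto simp: a_def b_def)
      define z where "z = (\<lambda>k. a * x k + b * ?y k)"
      have "B z z < 0" unfolding z_def B_combination
        using ab x y xy by (intro add_neg_neg mult_pos_neg) (auto simp: neg_def)
      then have "neg I z" using x y by (auto simp: neg_def z_def)
      moreover have "B z u = 0" by (simp add: z_def bil_linear_left a_def b_def)
      ultimately show False using nonorth u by blast
    qed
    then show ?thesis using y nonorth[OF y u] by linarith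
  qed
  define c where "c = act n A (sorted_list_of_set I)"
  have cone_c: "neg I (c x) \<and> B (c x) u < 0" if "neg I x" "B x u < 0" for x
  proof -
    have "neg I (act n A w x) \<and> B (act n A w x) u < 0" if "set w \<subseteq> I" for w
      using that \<open>neg I x\<close> \<open>B x u < 0\<close> by (induction w) (simp_all add: cone)
    then show ?thesis using finI by (simp add: c_def)
  qed
  have cone_pow: "neg I ((c ^^ k) u) \<and> B ((c ^^ k) u) u < 0" for k
    by (induction k) (use u cone_c in \<open>auto simp: neg_def\<close>)
  obtain M where M: "M > 0" "\<And>i. i \<in> I \<Longrightarrow> (c ^^ M) (e i) = e i"
    unfolding c_def using finite_order[OF I] by blast
  have u_sum: "u = (\<lambda>k. \<Sum>i\<in>I. u i * e i k)"
  proof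
    fix k
    have "(\<Sum>i\<in>I. u i * e i k) = (\<Sum>i\<in>I. if i = k then u k else 0)"
      by (intro sum.cong) (auto simp: unitv_def)
    then show "u k = (\<Sum>i\<in>I. u i * e i k)" using u finI by (auto simp: neg_def)
  qed
  have period: "(c ^^ M) u = u"
  proof -
    have "(c ^^ M) u = (\<lambda>k. \<Sum>i\<in>I. u i * (c ^^ M) (e i) k)"
      unfolding c_def act_concat_replicate[symmetric] by (subst u_sum) (rule act_sum)
    also have "\<dots> = (\<lambda>k. \<Sum>i\<in>I. u i * e i k)"
      by (intro ext sum.cong HOL.refl) (simp only: M(2))
    also have "\<dots> = u" by (rule u_sum[symmetric])
    finally show ?thesis .
  qed
  \<comment> \<open>The factor \<open>1\<close> puts the sum into the shape of \<open>act_sum\<close>.\<close>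
  define v where "v = (\<lambda>k. \<Sum>l<M. 1 * (c ^^ l) u k)"
  have "c v = v"
  proof -
    have "c v = (\<lambda>k. \<Sum>l<M. (c ^^ Suc l) u k)"
      unfolding v_def c_def act_sum by simp
    also have "\<dots> = v"
      using sum.lessThan_Suc_shift[of "\<lambda>l. (c ^^ l) u k" M for k] period
      by (auto simp: v_def fun_eq_iff algebra_simps)
    finally show ?thesis .
  qed
  have orth: "B (e i) v = 0" if "i \<in> I" for i
    using fixed_by_distinct_product[of "sorted_list_of_set I" v i] that I finI \<open>c v = v\<close>
    by (simp add: c_def)
  have "B v u = B u v" by (rule B_sym)
  also have "B u v = (\<Sum>i\<in>I. u i * B (e i) v)"
    by (subst u_sum) (simp add: bil_linear_left)
  also have "\<dots> = 0" by (simp add: orth)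
  finally have "B v u = 0" .
  moreover have "B v u = (\<Sum>l<M. B ((c ^^ l) u) u)"
    unfolding v_def by (simp add: bil_linear_left)
  moreover have "\<dots> < 0"
    using M(1) cone_pow sum_strict_mono[of "{..<M}" "\<lambda>l. B ((c ^^ l) u) u" "\<lambda>_. 0"] by auto
  ultimately show False by simp
qed

text \<open>The Cauchy-Schwarz inequality of a semidefinite form, for two vectors of norm \<open>2\<close>.\<close>

lemma matrix_coefficient_bound:
  assumes w: "set w \<subseteq> {..<n}" and "i < n" "j < n"
  shows "\<bar>B (e i) (act n A w (e j))\<bar> \<le> 2"
proof -
  let ?y = "act n A w (e j)"
  have "B ?y ?y = 2" using assms by (simp add: B_act B_e)
  moreover have "B (\<lambda>k. e i k + ?y k) (\<lambda>k. e i k + ?y k) \<ge> 0"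
    "B (\<lambda>k. e i k - ?y k) (\<lambda>k. e i k - ?y k) \<ge> 0"
    by (rule positive_semidefinite)+
  ultimately show ?thesis using assms B_sym[of ?y "e i"]
    by (simp add: bil_linear_left bil_linear_right B_e)
qed

text \<open>With \<open>A i j = z + 1/z\<close>, the product of the two reflections acts on the plane of the two roots
with eigenvalues \<open>z ^ 2\<close> and \<open>z ^ (-2)\<close>. An eigenfunctional \<open>f\<close> for \<open>z ^ 2\<close> is written down explicitly; since
\<open>f (e i) = 1 - z ^ 2\<close>, either \<open>z ^ 2 = 1\<close> or the finite order of the product makes \<open>z\<close> a root of unity.\<close>

lemma entry_root_of_unity:
  assumes ij: "i < j" "j < n"
  obtains z :: complex and M where "M > 0" "z ^ M = 1" "of_real (A i j) = z + inverse z"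
proof -
  define C where "C = (of_real (A i j) :: complex)"
  define z where "z = (C + csqrt (C\<^sup>2 - 4)) / 2"
  have "2 * z - C = csqrt (C\<^sup>2 - 4)" by (simp add: z_def field_simps)
  then have *: "(2 * z - C)\<^sup>2 = C\<^sup>2 - 4" by simp
  have "4 * (z * z - (C * z - 1)) = (2 * z - C)\<^sup>2 - (C\<^sup>2 - 4)"
    by (simp add: power2_eq_square algebra_simps)
  also have "\<dots> = 0" using * by simp
  finally have "z * z - (C * z - 1) = 0" by (simp only: mult_eq_0_iff) simp
  then have zz: "z * z = C * z - 1" by simp
  then have z0: "z \<noteq> 0" by auto
  have Cz: "C = z + inverse z" using zz z0 by (simp add: field_simps)
  define f where "f = (\<lambda>x. of_real (B (e i) x) - z * of_real (B (e j) x))"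
  have f_step: "f (coord_refl n A i (coord_refl n A j x)) = z * z * f x" for x
  proof -
    define p q where "p = (of_real (B (e i) x) :: complex)" and "q = (of_real (B (e j) x) :: complex)"
    have "f (coord_refl n A i (coord_refl n A j x)) = (C * q - p) - z * (C * (C * q - p) - q)"
      using ij sym[of i j] by (simp add: f_def coord_refl_eq bil_linear_right bil_unitv_unitv diag
          C_def p_def q_def algebra_simps)
    also have "\<dots> = z * z * (p - z * q) + (z * z - (C * z - 1)) * (- p + C * q + z * q)"
      by (simp add: algebra_simps)
    finally show ?thesis by (simp add: zz f_def p_def q_def)
  qed
  obtain M where M: "M > 0" "\<And>k. k \<in> {i, j} \<Longrightarrow>
      (act n A (sorted_list_of_set {i, j}) ^^ M) (e k) = e k"
    using finite_order[of "{i, j}"] ij by auto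
  have "sorted_list_of_set {i, j} = [i, j]"
    using ij by (simp add: sorted_list_of_set.idem_if_sorted_distinct[of "[i, j]", simplified])
  then have fixed: "((\<lambda>x. coord_refl n A i (coord_refl n A j x)) ^^ M) (e i) = e i"
    using M(2)[of i] by (simp add: act_def comp_def)
  have "f (((\<lambda>x. coord_refl n A i (coord_refl n A j x)) ^^ k) x) = (z * z) ^ k * f x" for k x
    by (induction k) (simp_all add: f_step)
  from this[of M "e i"] have "f (e i) = (z * z) ^ M * f (e i)" by (simp add: fixed)
  moreover have "f (e i) = 1 - z * z"
    using ij sym[of i j] by (simp add: f_def bil_unitv_unitv diag zz C_def)
  ultimately have "z * z = 1 \<or> (z * z) ^ M = 1" by auto
  then have "z ^ (2 * M) = 1" by (auto simp: power_mult power2_eq_square)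
  then show ?thesis using that[of "2 * M" z] M(1) Cz by (simp add: C_def)
qed

end

section \<open>Cyclotomic integers with bounded conjugates\<close>

abbreviation ev :: "complex \<Rightarrow> int poly \<Rightarrow> complex" where
  "ev z p \<equiv> poly (map_poly of_int p) z"

lemma ev_hom:
  "ev z (p + q) = ev z p + ev z q" "ev z (p - q) = ev z p - ev z q"
  "ev z (p * q) = ev z p * ev z q" "ev z 0 = 0" "ev z 1 = 1"
  by (simp_all add: hom_distribs)

lemma ev_sum: "ev z (\<Sum>i\<in>A. p i) = (\<Sum>i\<in>A. ev z (p i))"
  by (induction A rule: infinite_finite_induct) (simp_all add: ev_hom)

text \<open>A prime factor \<open>m\<close> of \<open>X ^ N - 1\<close> over \<open>\<int>\<close> that vanishes at \<open>z\<close> has leading coefficient \<open>1\<close> or \<open>-1\<close>.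
Primality together with pseudo-division by a polynomial \<open>q0\<close> of least degree vanishing at \<open>z\<close> shows
that \<open>m\<close> has this least degree itself, so that division by \<open>m\<close> leaves no remainder.\<close>

lemma min_poly_root_of_unity:
  assumes N: "N > 0" and z: "z ^ N = 1"
  obtains m :: "int poly" where "m dvd monom 1 N - 1" "\<bar>lead_coeff m\<bar> = 1"
    "\<And>q. ev z q = 0 \<longleftrightarrow> m dvd q"
proof -
  let ?u = "monom 1 N - 1 :: int poly"
  have lc: "lead_coeff ?u = 1" and u0: "?u \<noteq> 0"
  proof -
    have "coeff ?u N = 1" using N by simp
    moreover have "degree ?u = N"
      using N by (intro antisym degree_le le_degree) auto
    ultimately show "lead_coeff ?u = 1" "?u \<noteq> 0" by auto
  qed
  have evu: "ev z ?u = 0"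
    using z by (simp add: ev_hom poly_monom)
  obtain m where m: "prime_elem m" "m dvd ?u" "ev z m = 0"
  proof -
    obtain A where A: "\<And>x. x \<in># A \<Longrightarrow> prime x" "normalize (prod_mset A) = normalize ?u"
      using prime_factorization_exists'[OF u0] by blast
    have "?u dvd normalize (prod_mset A)" unfolding A(2) by simp
    then have "?u dvd prod_mset A" by (simp only: dvd_normalize_iff)
    then have "ev z (prod_mset A) = 0" using evu by (auto simp: ev_hom elim!: dvdE)
    then have "\<exists>x. x \<in># A \<and> ev z x = 0"
      by (induction A) (auto simp: ev_hom)
    then obtain x where x: "x \<in># A" "ev z x = 0" by blast
    moreover have "x dvd ?u"
    proof -
      have "x dvd normalize ?u" unfolding A(2)[symmetric]
        using dvd_prod_mset[OF x(1)] by (simp only: dvd_normalize_iff)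
      then show ?thesis by (simp only: dvd_normalize_iff)
    qed
    ultimately show ?thesis using A(1) that by (blast intro: prime_imp_prime_elem)
  qed
  have m0: "m \<noteq> 0" using m(1) by auto
  have lcm: "\<bar>lead_coeff m\<bar> = 1"
  proof -
    obtain h where h: "?u = m * h" using m(2) unfolding dvd_def by blast
    have "lead_coeff m * lead_coeff h = lead_coeff ?u" unfolding h by (rule lead_coeff_mult[symmetric])
    then have "lead_coeff m dvd 1" unfolding lc by (rule dvdI[OF HOL.sym])
    then show ?thesis by (rule zdvd1_eq[THEN iffD1])
  qed
  obtain q0 where q0: "q0 \<noteq> 0" "ev z q0 = 0" and min: "\<And>q. q \<noteq> 0 \<Longrightarrow> ev z q = 0 \<Longrightarrow> degree q0 \<le> degree q"
    using ex_has_least_nat[of "\<lambda>q. q \<noteq> 0 \<and> ev z q = 0" m degree] m0 m(3) by blast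
  have pdiv: "\<exists>s k. Polynomial.smult (lead_coeff p ^ k) q = p * s"
    if "ev z q = 0" "p \<noteq> 0" "ev z p = 0" "degree p \<le> degree q0" for p q
  proof -
    define k where "k = Suc (degree q) - degree p"
    obtain s r where sr: "pseudo_divmod q p = (s, r)" by force
    note d = pseudo_divmod[OF that(2) sr]
    have "ev z (Polynomial.smult (lead_coeff p ^ k) q) = ev z (p * s + r)"
      using d(1) by (simp add: k_def)
    then have "ev z r = 0" using that by (simp add: ev_hom hom_distribs)
    then have "r = 0" using d(2) min[of r] that(4) by force
    then show ?thesis using d(1) by (auto simp: k_def)
  qed
  have "m dvd q0"
  proof -
    obtain s k where s: "Polynomial.smult (lead_coeff q0 ^ k) m = q0 * s"
      using pdiv[OF m(3) q0] by auto
    have "m dvd q0 * s" unfolding s[symmetric] by (rule dvd_smult) simp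
    then consider "m dvd q0" | "m dvd s" using m(1) by (auto simp: prime_elem_dvd_mult_iff)
    then show ?thesis
    proof cases
      case 2
      then obtain t where "s = m * t" by auto
      then have "m * (q0 * t) = m * [:lead_coeff q0 ^ k:]" using s by (simp add: algebra_simps)
      then have e: "q0 * t = [:lead_coeff q0 ^ k:]" using mult_left_cancel[OF m0] by blast
      moreover have "ev z (q0 * t) = 0" using q0 by (simp add: ev_hom)
      ultimately show ?thesis using q0(1) by (simp add: hom_distribs)
    qed
  qed
  then have deg: "degree m \<le> degree q0" using q0(1) by (rule dvd_imp_degree_le)
  have "m dvd q" if q: "ev z q = 0" for q
  proof -
    obtain s k where s: "Polynomial.smult (lead_coeff m ^ k) q = m * s"
      using pdiv[OF q m0 m(3) deg] by auto
    define l where "l = lead_coeff m ^ k"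
    have "\<bar>l\<bar> = 1" using lcm by (simp add: l_def power_abs)
    then have ll: "l * l = 1" using abs_mult_self_eq[of l] by simp
    have "q = Polynomial.smult l (Polynomial.smult l q)" by (simp add: ll)
    also have "\<dots> = m * Polynomial.smult l s" unfolding l_def s by simp
    finally show ?thesis by (rule dvdI)
  qed
  moreover have "ev z q = 0" if "m dvd q" for q
    using that m(3) by (auto simp: ev_hom elim!: dvdE)
  ultimately show ?thesis using that m(2) lcm by blast
qed

text \<open>The numbers \<open>w\<close> in the statement are the conjugates of \<open>z\<close>, that is, the roots of its minimal
polynomial \<open>m\<close>. Modulo \<open>m\<close> a polynomial may be taken of degree less than \<open>degree m\<close>. It is then
recovered from its values at the roots by Lagrange interpolation, because \<open>m\<close> divides the separable
polynomial \<open>X ^ N - 1\<close> and so has \<open>degree m\<close> distinct roots. Thus its integer coefficients are bounded.\<close>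

lemma finite_bounded_conjugates:
  fixes B :: real
  assumes N: "N > 0" and z: "z ^ N = 1"
  shows "finite (ev z ` {p. \<forall>w. (\<forall>q. ev z q = 0 \<longrightarrow> ev w q = 0) \<longrightarrow> norm (ev w p) \<le> B})"
    (is "finite (_ ` ?X)")
proof -
  obtain m :: "int poly" where m: "m dvd monom 1 N - 1" "\<bar>lead_coeff m\<bar> = 1"
    and mz: "\<And>q. ev z q = 0 \<longleftrightarrow> m dvd q"
    using min_poly_root_of_unity[OF N z] by blast
  let ?m = "map_poly of_int m :: complex poly"
  define R where "R = {w. ev w m = 0}"
  have m0: "m \<noteq> 0"
  proof
    assume "m = 0"
    show False using m(2) unfolding \<open>m = 0\<close> by simp
  qed
  have m0': "?m \<noteq> 0" using m0 by simp
  have finR: "finite R" unfolding R_def using m0' by (rule poly_roots_finite)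
  have cardR: "card R = degree m"
  proof -
    have "rsquarefree ?m"
      unfolding rsquarefree_roots
    proof (intro allI notI, elim conjE)
      fix a assume a: "poly ?m a = 0" "poly (pderiv ?m) a = 0"
      obtain h where h: "monom 1 N - 1 = m * h" using m(1) by auto
      let ?h = "map_poly of_int h :: complex poly"
      have "(map_poly of_int (monom 1 N - 1) :: complex poly) = ?m * ?h"
        unfolding h by (simp add: hom_distribs)
      then have e: "monom 1 N - 1 = ?m * ?h" by (simp add: hom_distribs)
      have "poly (monom 1 N - 1) a = 0" unfolding e using a by simp
      then have 1: "a ^ N = 1" by (simp add: poly_monom)
      have "poly (pderiv (monom 1 N - 1)) a = 0" unfolding e pderiv_mult using a by simp
      then have "of_nat N * a ^ (N - 1) = 0" by (simp add: pderiv_diff pderiv_monom poly_monom)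
      then show False using 1 N by (auto simp: power_0_left)
    qed
    then have "Polynomial.smult (lead_coeff ?m) (\<Prod>w\<in>R. [:-w, 1:]) = ?m"
      unfolding R_def by (rule complex_poly_decompose_rsquarefree)
    then have "degree ?m = degree (Polynomial.smult (lead_coeff ?m) (\<Prod>w\<in>R. [:-w, 1:]))"
      by (simp only:)
    also have "\<dots> = degree (\<Prod>w\<in>R. [:-w, 1:])"
      using m0 by simp
    also have "\<dots> = card R" by (subst degree_prod_sum_eq) auto
    finally show ?thesis by simp
  qed
  define L where "L = (\<lambda>w. \<Prod>v\<in>R - {w}. Polynomial.smult (1 / (w - v)) [:-v, 1:])"
  have L: "poly (L w) v = (if v = w then 1 else 0)" if "w \<in> R" "v \<in> R" for v w
  proof -
    have "poly (L w) v = (\<Prod>x\<in>R - {w}. (v - x) / (w - x))"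
      unfolding L_def poly_prod by (intro prod.cong refl) (simp only: poly_smult, simp add: diff_divide_distrib)
    moreover have "\<dots> = (if v = w then 1 else 0)"
    proof (cases "v = w")
      case True
      then show ?thesis by (auto intro!: prod.neutral split: if_splits)
    next
      case False
      then have "\<exists>x\<in>R - {w}. (v - x) / (w - x) = 0" using that by (intro bexI[of _ v]) auto
      then show ?thesis using False finR by (simp only: prod_zero_iff finite_Diff if_False)
    qed
    ultimately show ?thesis by simp
  qed
  have degL: "degree (L w) < card R" if "w \<in> R" for w
  proof -
    have "degree (L w) \<le> (\<Sum>v\<in>R - {w}. degree (Polynomial.smult (1 / (w - v)) [:-v, 1:]))"
      unfolding L_def
      using degree_prod_sum_le[OF finite_Diff[OF finR], of "\<lambda>v. Polynomial.smult (1 / (w - v)) [:-v, 1:]" "{w}"]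
      by (simp only: o_def)
    also have "\<dots> \<le> (\<Sum>v\<in>R - {w}. 1)" by (intro sum_mono) auto
    also have "\<dots> = card (R - {w})" by simp
    also have "\<dots> < card R" by (rule card_Diff1_less[OF finR that])
    finally show ?thesis .
  qed
  define K where "K = (\<lambda>i. \<Sum>w\<in>R. \<bar>B\<bar> * norm (coeff (L w) i))"
  define Y where "Y = {p :: int poly. degree p \<le> degree m \<and> (\<forall>i. \<bar>real_of_int (coeff p i)\<bar> \<le> K i)}"
  have "finite Y"
  proof -
    let ?I = "{..degree m}"
    have "inj_on (\<lambda>p. restrict (coeff p) ?I) Y"
    proof (rule inj_onI)
      fix p q assume "p \<in> Y" "q \<in> Y" and e: "restrict (coeff p) ?I = restrict (coeff q) ?I"
      then have d: "degree p \<le> degree m" "degree q \<le> degree m" by (auto simp: Y_def)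
      show "p = q"
      proof (rule poly_eqI)
        fix i show "coeff p i = coeff q i"
        proof (cases "i \<le> degree m")
          case True then show ?thesis using fun_cong[OF e, of i] by simp
        next
          case False then show ?thesis using d by (simp add: coeff_eq_0)
        qed
      qed
    qed
    moreover have "(\<lambda>p. restrict (coeff p) ?I) ` Y \<subseteq> (\<Pi>\<^sub>E i\<in>?I. {-\<lfloor>K i\<rfloor>..\<lfloor>K i\<rfloor>})"
    proof -
      have "- \<lfloor>K i\<rfloor> \<le> c \<and> c \<le> \<lfloor>K i\<rfloor>" if "\<bar>real_of_int c\<bar> \<le> K i" for c i
        using that by (auto simp: le_floor_iff minus_le_iff)
      then show ?thesis unfolding Y_def
        by (intro image_subsetI) (simp only: restrict_PiE_iff atLeastAtMost_iff mem_Collect_eq, blast)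
    qed
    moreover have "finite (\<Pi>\<^sub>E i\<in>?I. {-\<lfloor>K i\<rfloor>..\<lfloor>K i\<rfloor>})" by (intro finite_PiE) auto
    ultimately show ?thesis by (rule finite_imageD[OF finite_subset, rotated 2])
  qed
  moreover have "ev z ` ?X \<subseteq> ev z ` Y"
  proof (rule image_subsetI)
    fix p assume p: "p \<in> ?X"
    obtain s r where sr: "pseudo_divmod p m = (s, r)" by force
    define k where "k = Suc (degree p) - degree m"
    note d = pseudo_divmod[OF m0 sr]
    define l where "l = lead_coeff m ^ k"
    have l: "\<bar>l\<bar> = 1" using m(2) by (simp add: l_def power_abs)
    then have ll: "l * l = 1" using abs_mult_self_eq[of l] by simp
    \<comment> \<open>As \<open>l\<close> is a sign, the pseudo-division by \<open>m\<close> is a division with remainder \<open>t\<close>.\<close>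
    define t where "t = Polynomial.smult l r"
    have pt: "p = m * Polynomial.smult l s + t"
    proof -
      have "Polynomial.smult l (Polynomial.smult l p) = Polynomial.smult l (m * s + r)" using d(1) by (simp add: l_def k_def)
      then show ?thesis by (simp add: ll t_def smult_add_right)
    qed
    have eq: "ev w p = ev w t" if "w \<in> R" for w
      using that unfolding pt by (simp add: ev_hom R_def hom_distribs)
    have zR: "z \<in> R" using mz[of m] by (simp add: R_def)
    have dt: "degree t < degree m"
    proof -
      have "card R \<noteq> 0" using zR finR by auto
      then have "degree m \<noteq> 0" unfolding cardR .
      then show ?thesis using d(2) l by (auto simp: t_def)
    qed
    have bnd: "norm (ev w t) \<le> \<bar>B\<bar>" if "w \<in> R" for w
    proof -
      have "ev w q = 0" if "ev z q = 0" for q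
        using that \<open>w \<in> R\<close> by (auto simp: mz R_def ev_hom elim!: dvdE)
      then have "norm (ev w p) \<le> B" using p by (simp only: mem_Collect_eq) simp
      then show ?thesis using eq[OF that] by simp
    qed
    have "map_poly of_int t = (\<Sum>w\<in>R. Polynomial.smult (ev w t) (L w))"
    proof (rule poly_eqI_degree[of R])
      fix v assume v: "v \<in> R"
      have "poly (\<Sum>w\<in>R. Polynomial.smult (ev w t) (L w)) v = (\<Sum>w\<in>R. if w = v then ev w t else 0)"
        using v by (auto simp: poly_sum L intro!: sum.cong)
      also have "\<dots> = ev v t" using v finR by simp
      finally show "ev v t = poly (\<Sum>w\<in>R. Polynomial.smult (ev w t) (L w)) v" ..
    next
      show "degree (map_poly of_int t :: complex poly) < card R" using dt cardR by simp
      have "card R > 0" using zR finR by (auto simp: card_gt_0_iff)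
      have "degree (Polynomial.smult (ev w t) (L w)) \<le> card R - 1" if "w \<in> R" for w
        using degL[OF that] degree_smult_le[of "ev w t" "L w"] by linarith
      then have "degree (\<Sum>w\<in>R. Polynomial.smult (ev w t) (L w)) \<le> card R - 1"
        using finR by (intro degree_sum_le) auto
      then show "degree (\<Sum>w\<in>R. Polynomial.smult (ev w t) (L w)) < card R" using \<open>card R > 0\<close> by simp
    qed
    then have "coeff (map_poly of_int t) i = coeff (\<Sum>w\<in>R. Polynomial.smult (ev w t) (L w)) i" for i
      by (simp only:)
    then have c: "complex_of_int (coeff t i) = (\<Sum>w\<in>R. ev w t * coeff (L w) i)" for i
      by (simp add: coeff_sum)
    have "\<bar>real_of_int (coeff t i)\<bar> \<le> K i" for i
    proof -
      have "\<bar>real_of_int (coeff t i)\<bar> = norm (complex_of_int (coeff t i))" by simp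
      also have "\<dots> \<le> (\<Sum>w\<in>R. norm (ev w t * coeff (L w) i))" unfolding c by (rule norm_sum)
      also have "\<dots> \<le> K i" unfolding K_def
        by (intro sum_mono) (simp add: norm_mult mult_right_mono bnd)
      finally show ?thesis .
    qed
    then have "t \<in> Y" using dt by (simp add: Y_def)
    then show "ev z p \<in> ev z ` Y" unfolding eq[OF zR] by (rule imageI)
  qed
  ultimately show ?thesis by (rule finite_subset[OF _ finite_imageI, rotated])
qed

section \<open>Conjugate Cartan matrices\<close>

lemma act_cong:
  assumes "\<And>i j. i < n \<Longrightarrow> j < n \<Longrightarrow> A i j = A' i j" "set w \<subseteq> {..<n}"
  shows "act n A w x = act n A' w x"
  using assms(2) by (induction w) (simp_all add: coord_refl_def assms(1) cong: sum.cong_simp)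

lemma act_specialize:
  fixes P :: "nat \<Rightarrow> nat \<Rightarrow> int poly" and R :: "nat \<Rightarrow> nat \<Rightarrow> real"
  assumes P: "\<And>i j. i < n \<Longrightarrow> j < n \<Longrightarrow> ev z (P i j) = of_real (R i j)"
    and w: "set w \<subseteq> {..<n}"
  shows "ev z (act n P w (unitv j) k) = of_real (act n R w (unitv j) k)"
proof -
  have "ev z (act n P w (unitv j) k) = act n (\<lambda>i j. ev z (P i j)) w (\<lambda>k. ev z (unitv j k)) k"
    by (rule act_hom) (simp_all only: ev_hom ev_sum)
  also have "\<dots> = act n (\<lambda>i j. of_real (R i j)) w (\<lambda>k. ev z (unitv j k)) k"
    by (rule arg_cong[where f = "\<lambda>f. f k"], rule act_cong[OF P w])
  also have "(\<lambda>k. ev z (unitv j k)) = (\<lambda>k. of_real (unitv j k))"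
    by (simp add: unitv_def fun_eq_iff ev_hom)
  also have "act n (\<lambda>i j. complex_of_real (R i j)) w (\<lambda>k. of_real (unitv j k)) k =
      of_real (act n R w (unitv j) k)"
    by (rule act_hom[symmetric]) simp_all
  finally show ?thesis .
qed

context torsion_cartan
begin

lemma common_root_of_unity:
  obtains N where "N > 0"
    "\<And>i j. i < n \<Longrightarrow> j < n \<Longrightarrow> \<exists>z::complex. z ^ N = 1 \<and> of_real (A i j) = z + inverse z"
proof -
  define Q where "Q = (\<lambda>i j M. M > 0 \<and> (\<exists>z::complex. z ^ M = 1 \<and> of_real (A i j) = z + inverse z))"
  have ex: "\<exists>M. Q i j M" if ij: "i < n" "j < n" for i j
  proof -
    consider "i < j" | "j < i" | "i = j" by linarith
    then show ?thesis
    proof cases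
      case 1
      then show ?thesis
        unfolding Q_def by (rule entry_root_of_unity[OF _ ij(2)]) blast
    next
      case 2
      then show ?thesis unfolding Q_def sym[OF ij] by (rule entry_root_of_unity[OF _ ij(1)]) blast
    next
      case 3
      then show ?thesis
        unfolding Q_def using diag[OF ij(1)] by (intro exI[of _ 1] conjI exI[of _ 1]) auto
    qed
  qed
  define M where "M = (\<lambda>i j. SOME M. Q i j M)"
  have M: "M i j > 0 \<and> (\<exists>z::complex. z ^ M i j = 1 \<and> of_real (A i j) = z + inverse z)"
    if "i < n" "j < n" for i j
    using someI_ex[OF ex[OF that]] unfolding M_def Q_def .
  show ?thesis
  proof (rule that[of "\<Prod>i<n. \<Prod>j<n. M i j"])
    show "(\<Prod>i<n. \<Prod>j<n. M i j) > 0" using M by (intro prod_pos) auto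
    fix i j assume ij: "i < n" "j < n"
    have "M i j dvd (\<Prod>j<n. M i j)" using ij by (intro dvd_prodI) auto
    also have "(\<Prod>j<n. M i j) dvd (\<Prod>i<n. \<Prod>j<n. M i j)" using ij by (intro dvd_prodI) auto
    finally obtain q where q: "(\<Prod>i<n. \<Prod>j<n. M i j) = M i j * q" by auto
    obtain z :: complex where "z ^ M i j = 1" "of_real (A i j) = z + inverse z"
      using M ij by blast
    then show "\<exists>z::complex. z ^ (\<Prod>i<n. \<Prod>j<n. M i j) = 1 \<and> of_real (A i j) = z + inverse z"
      by (intro exI[of _ z]) (simp add: q power_mult)
  qed
qed

text \<open>With \<open>z\<close> a primitive \<open>N\<close>-th root of unity and \<open>A i j = z ^ k + 1 / z ^ k\<close>, the polynomial
\<open>X ^ k + X ^ (k * (N - 1))\<close> is chosen for the entry. It is real at every \<open>N\<close>-th root of unity because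
inversion is complex conjugation there. The choice depends only on the value of the entry, which
keeps \<open>P\<close> symmetric. The value \<open>2\<close> is given the constant polynomial, as the diagonal must remain
equal to \<open>2\<close> at all conjugates.\<close>

lemma cyclotomic_entries:
  obtains N and z :: complex and P :: "nat \<Rightarrow> nat \<Rightarrow> int poly" where "N > 0" "z ^ N = 1"
    "\<And>i j. i < n \<Longrightarrow> j < n \<Longrightarrow> ev z (P i j) = of_real (A i j)"
    "\<And>i j w. i < n \<Longrightarrow> j < n \<Longrightarrow> w ^ N = 1 \<Longrightarrow> ev w (P i j) \<in> \<real>"
    "\<And>i j. i < n \<Longrightarrow> j < n \<Longrightarrow> P i j = P j i"
    "\<And>i. i < n \<Longrightarrow> P i i = [:2:]"
proof -
  obtain N where N: "N > 0" and roots: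
    "\<And>i j. i < n \<Longrightarrow> j < n \<Longrightarrow> \<exists>z::complex. z ^ N = 1 \<and> of_real (A i j) = z + inverse z"
    using common_root_of_unity by blast
  define z where "z = exp (2 * of_real pi * \<i> / of_nat N)"
  have zN: "z ^ N = 1" using N by (simp add: z_def flip: exp_of_nat_mult)
  have inv: "inverse y = y ^ (N - 1)" "cnj y = inverse y" if y: "y ^ N = 1" for y :: complex
  proof -
    have "y * y ^ (N - 1) = 1" using y N by (simp flip: power_Suc)
    then show "inverse y = y ^ (N - 1)" by (rule inverse_unique)
    have "norm y ^ N = 1" using y by (simp flip: norm_power)
    then have "norm y = 1" using N power_eq_imp_eq_base[of "norm y" N 1] by simp
    then have "y * cnj y = 1" by (simp add: complex_norm_square[symmetric])
    then show "cnj y = inverse y" by (rule inverse_unique[symmetric])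
  qed
  define good where "good = (\<lambda>(c::real) p. ev z p = of_real c \<and>
    (\<forall>w. w ^ N = 1 \<longrightarrow> ev w p \<in> \<real>) \<and> (c = 2 \<longrightarrow> p = [:2:]))"
  have ex: "\<exists>p. good (A i j) p" if ij: "i < n" "j < n" for i j
  proof (cases "A i j = 2")
    case True
    have "good (A i j) [:2:]" unfolding good_def using True by (simp add: hom_distribs)
    then show ?thesis by blast
  next
    case False
    obtain y :: complex where y: "y ^ N = 1" "of_real (A i j) = y + inverse y" using roots[OF ij] by blast
    then have "y \<in> {exp (2 * of_real pi * \<i> * of_nat j / of_nat N) |j. j < N}"
      using complex_roots_unity[of N] N by auto
    then obtain k where "y = exp (2 * of_real pi * \<i> * of_nat k / of_nat N)" by blast
    also have "\<dots> = z ^ k" by (simp add: z_def mult_ac flip: exp_of_nat_mult)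
    finally have k: "y = z ^ k" .
    let ?p = "monom 1 k + monom 1 (k * (N - 1)) :: int poly"
    have ev: "ev w ?p = w ^ k + inverse (w ^ k)" if "w ^ N = 1" for w
    proof -
      have "(w ^ k) ^ N = 1" using power_mult[of w k N] power_mult[of w N k] that by (simp add: mult.commute)
      from inv(1)[OF this] show ?thesis by (simp add: ev_hom poly_monom power_mult)
    qed
    have "ev w ?p \<in> \<real>" if w: "w ^ N = 1" for w
    proof -
      have "(w ^ k) ^ N = 1" using power_mult[of w k N] power_mult[of w N k] that by (simp add: mult.commute)
      from inv(2)[OF this] have "ev w ?p = w ^ k + cnj (w ^ k)" unfolding ev[OF w] by simp
      also have "\<dots> \<in> \<real>" unfolding complex_add_cnj by simp
      finally show ?thesis .
    qed
    then have "good (A i j) ?p" unfolding good_def using ev[OF zN] y(2) k False by simp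
    then show ?thesis by blast
  qed
  have some: "good (A i j) (SOME p. good (A i j) p)" if "i < n" "j < n" for i j
    using someI_ex[OF ex[OF that]] .
  show ?thesis
  proof (rule that[OF N zN, of "\<lambda>i j. SOME p. good (A i j) p"])
    fix i j assume ij: "i < n" "j < n"
    show "ev z (SOME p. good (A i j) p) = of_real (A i j)"
      using some[OF ij] unfolding good_def by blast
    show "(SOME p. good (A i j) p) = (SOME p. good (A j i) p)"
      using sym[OF ij] by simp
    show "ev w (SOME p. good (A i j) p) \<in> \<real>" if "w ^ N = 1" for w
      using some[OF ij] that unfolding good_def by blast
  next
    fix i assume "i < n"
    then show "(SOME p. good (A i i) p) = [:2:]"
      using some[of i i] diag[of i] unfolding good_def by blast
  qed
qed

text \<open>For each conjugate \<open>y\<close> of \<open>z\<close> the specialized matrix \<open>R\<close> satisfies the same hypotheses as \<open>A\<close>,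
hence the same bound \<open>2\<close> on the coefficients.\<close>

lemma finite_matrix_coefficients:
  "finite {B (e i) (act n A w (e j)) |i j w. i < n \<and> j < n \<and> set w \<subseteq> {..<n}}"
    (is "finite ?S")
proof -
  obtain N and z :: complex and P :: "nat \<Rightarrow> nat \<Rightarrow> int poly" where N: "N > 0" "z ^ N = 1"
    and P: "\<And>i j. i < n \<Longrightarrow> j < n \<Longrightarrow> ev z (P i j) = of_real (A i j)"
    and P_real: "\<And>i j w. i < n \<Longrightarrow> j < n \<Longrightarrow> w ^ N = 1 \<Longrightarrow> ev w (P i j) \<in> \<real>"
    and P_sym: "\<And>i j. i < n \<Longrightarrow> j < n \<Longrightarrow> P i j = P j i"
    and P_diag: "\<And>i. i < n \<Longrightarrow> P i i = [:2:]"
    using cyclotomic_entries by blast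
  let ?Z = "{p. \<forall>y. (\<forall>q. ev z q = 0 \<longrightarrow> ev y q = 0) \<longrightarrow> norm (ev y p) \<le> 2}"
  define p where "p = (\<lambda>i j w. \<Sum>k<n. P i k * act n P w (unitv j) k)"
  have ev_p: "ev y (p i j w) = of_real (bil n R (e i) (act n R w (e j)))"
    if "\<And>i j. i < n \<Longrightarrow> j < n \<Longrightarrow> ev y (P i j) = of_real (R i j)" "i < n" "set w \<subseteq> {..<n}" for y R i j w
    using that by (simp add: p_def ev_sum ev_hom bil_unitv act_specialize)
  have pZ: "p i j w \<in> ?Z" if ij: "i < n" "j < n" and w: "set w \<subseteq> {..<n}" for i j w
  proof (intro CollectI allI impI)
    fix y assume y: "\<forall>q. ev z q = 0 \<longrightarrow> ev y q = 0"
    have "ev z (monom 1 N - 1) = 0" using N by (simp add: ev_hom poly_monom)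
    then have "ev y (monom 1 N - 1) = 0" using y by blast
    then have yN: "y ^ N = 1" by (simp add: ev_hom poly_monom)
    define R where "R = (\<lambda>i j. Re (ev y (P i j)))"
    have R: "ev y (P i j) = of_real (R i j)" if "i < n" "j < n" for i j
      using P_real[OF that yN] by (simp add: R_def)
    interpret R: torsion_cartan n R
    proof
      show "R i j = R j i" if "i < n" "j < n" for i j
        using P_sym[OF that] by (simp add: R_def)
      show "R i i = 2" if "i < n" for i
        by (simp add: R_def P_diag[OF that] hom_distribs)
      fix I assume I: "I \<subseteq> {..<n}"
      have transfer: "act n R v (e j) = act n R w (e j)"
        if "act n A v (e j) = act n A w (e j)" "set v \<subseteq> {..<n}" "set w \<subseteq> {..<n}" for v w j
      proof
        fix k
        have "ev z (act n P v (unitv j) k - act n P w (unitv j) k) = 0"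
          using that P by (simp add: ev_hom act_specialize)
        then have "ev y (act n P v (unitv j) k - act n P w (unitv j) k) = 0" using y by blast
        then show "act n R v (e j) k = act n R w (e j) k"
          using that R by (simp add: ev_hom act_specialize)
      qed
      obtain m where m: "m > 0" "\<forall>i\<in>I.
        act n A (concat (replicate m (sorted_list_of_set I)) @ [i]) (e i) =
        act n A (i # concat (replicate m (sorted_list_of_set I))) (e i)"
        using comm[OF I] by blast
      have "finite I" using I finite_subset by blast
      then have "act n R (concat (replicate m (sorted_list_of_set I)) @ [i]) (e i) =
        act n R (i # concat (replicate m (sorted_list_of_set I))) (e i)" if "i \<in> I" for i
        using m(2) that I by (intro transfer) auto
      then show "\<exists>m>0. \<forall>i\<in>I.
        act n R (concat (replicate m (sorted_list_of_set I)) @ [i]) (e i) =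
        act n R (i # concat (replicate m (sorted_list_of_set I))) (e i)"
        using m(1) by blast
    qed
    show "norm (ev y (p i j w)) \<le> 2"
      using R.matrix_coefficient_bound[OF w ij] ev_p[of y R i w j] R ij w by simp
  qed
  have "?S \<subseteq> Re ` ev z ` ?Z"
  proof
    fix x assume "x \<in> ?S"
    then obtain i j w where x: "x = B (e i) (act n A w (e j))" "i < n" "j < n" "set w \<subseteq> {..<n}"
      by blast
    have "x = Re (ev z (p i j w))" using x ev_p[of z A i w j] P by simp
    then show "x \<in> Re ` ev z ` ?Z" using pZ[OF x(2-4)] by (simp only: image_eqI)
  qed
  moreover have "finite (Re ` ev z ` ?Z)"
    using finite_bounded_conjugates[OF N, of 2] by (rule finite_imageI)
  ultimately show ?thesis by (rule finite_subset)
qed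

end

section \<open>Hurwitz moves on subtuples\<close>

context group
begin

definition tuple_prod :: "'a list \<Rightarrow> 'a" where
  "tuple_prod us = foldr (\<otimes>) us \<one>"

definition conj_by :: "'a \<Rightarrow> 'a \<Rightarrow> 'a" where
  "conj_by c x = inv c \<otimes> x \<otimes> c"

lemma tuple_prod_simps [simp]:
  "tuple_prod [] = \<one>" "tuple_prod (x # us) = x \<otimes> tuple_prod us"
  by (simp_all add: tuple_prod_def)

lemma tuple_prod_closed [simp]: "set us \<subseteq> carrier G \<Longrightarrow> tuple_prod us \<in> carrier G"
  by (induction us) auto

lemma tuple_prod_append:
  "set us \<subseteq> carrier G \<Longrightarrow> set vs \<subseteq> carrier G \<Longrightarrow>
    tuple_prod (us @ vs) = tuple_prod us \<otimes> tuple_prod vs"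
  by (induction us) (auto simp: m_assoc)

lemma conj_by_closed [simp]: "c \<in> carrier G \<Longrightarrow> x \<in> carrier G \<Longrightarrow> conj_by c x \<in> carrier G"
  by (simp add: conj_by_def)

lemma conj_by_mult:
  "c \<in> carrier G \<Longrightarrow> d \<in> carrier G \<Longrightarrow> x \<in> carrier G \<Longrightarrow>
    conj_by d (conj_by c x) = conj_by (c \<otimes> d) x"
  by (simp add: conj_by_def inv_mult_group m_assoc)

lemma conj_by_one [simp]: "x \<in> carrier G \<Longrightarrow> conj_by \<one> x = x"
  by (simp add: conj_by_def)

lemma conj_by_inject:
  assumes "c \<in> carrier G" "x \<in> carrier G" "y \<in> carrier G" "conj_by c x = conj_by c y"
  shows "x = y"
proof -
  have "conj_by (inv c) (conj_by c x) = conj_by (inv c) (conj_by c y)" by (simp only: assms(4))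
  then show ?thesis using assms(1-3) by (simp add: conj_by_mult)
qed

lemma tuple_prod_map_conj:
  assumes "c \<in> carrier G" "set us \<subseteq> carrier G"
  shows "tuple_prod (map (conj_by c) us) = conj_by c (tuple_prod us)"
  using assms(2)
proof (induction us)
  case (Cons x us)
  then show ?case using assms(1)
    by (simp add: conj_by_def m_assoc inv_cancel)
qed (use assms(1) in \<open>simp add: conj_by_def\<close>)

text \<open>Reachability by the generators \<open>\<sigma>\<^sub>i\<close>. The relation does not mention positions, so that moves of a
block of entries are at once moves of every tuple containing this block.\<close>

inductive reach :: "'a list \<Rightarrow> 'a list \<Rightarrow> bool" where
  base: "reach s s"
| move: "reach s (p @ a # b # q) \<Longrightarrow> reach s (p @ b # conj_by b a # q)"

lemma reach_trans:
  assumes "reach s t" "reach t u"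
  shows "reach s u"
  using assms(2,1) by (induction rule: reach.induct) (auto intro: reach.intros)

lemma reach_context:
  assumes "reach s t"
  shows "reach (p @ s @ q) (p @ t @ q)"
  using assms
proof (induction rule: reach.induct)
  case (move s p' a b q')
  then show ?case using reach.move[of _ "p @ p'" a b "q' @ q"] by simp
qed (rule reach.base)

lemma reach_closed:
  assumes "reach s t" "set s \<subseteq> carrier G"
  shows "length t = length s \<and> set t \<subseteq> carrier G"
  using assms by (induction rule: reach.induct) auto

lemma reach_past:
  assumes "x \<in> carrier G" "set us \<subseteq> carrier G"
  shows "reach (x # us) (us @ [conj_by (tuple_prod us) x])"
  using assms
proof (induction us arbitrary: x)
  case Nil
  then show ?case by (simp add: reach.base)
next
  case (Cons u us)
  have "reach (x # u # us) (u # conj_by u x # us)"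
    using reach.move[OF reach.base, of "[]" x u us] by simp
  moreover have "reach (conj_by u x # us) (us @ [conj_by (tuple_prod us) (conj_by u x)])"
    using Cons.prems by (intro Cons.IH) auto
  then have "reach ([u] @ (conj_by u x # us) @ []) ([u] @ (us @ [conj_by (tuple_prod us) (conj_by u x)]) @ [])"
    by (rule reach_context)
  ultimately show ?case
    using Cons.prems by (auto simp: conj_by_mult intro: reach_trans)
qed

text \<open>An entry that does not belong to the subsequence is moved to the right past the part of the
subsequence behind it. Such a move conjugates only the entry that is discarded.\<close>

lemma reach_subseq:
  assumes "subseq us s" "set s \<subseteq> carrier G"
  shows "\<exists>rest. reach s (us @ rest)"
  using assms
proof (induction rule: list_emb.induct)
  case (list_emb_Nil ys)
  then show ?case using reach.base by auto
next
  case (list_emb_Cons xs ys y)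
  then obtain rest where r: "reach ys (xs @ rest)" by auto
  then have "reach ([y] @ ys @ []) ([y] @ (xs @ rest) @ [])" by (rule reach_context)
  moreover have xs: "set xs \<subseteq> carrier G"
    using reach_closed[OF r] list_emb_Cons.prems by simp
  have "reach ([] @ (y # xs) @ rest) ([] @ (xs @ [conj_by (tuple_prod xs) y]) @ rest)"
    using xs list_emb_Cons.prems by (intro reach_context reach_past) auto
  ultimately show ?case by (auto intro: reach_trans)
next
  case (list_emb_Cons2 x y xs ys)
  then obtain rest where r: "reach ys (xs @ rest)" by auto
  then have "reach ([y] @ ys @ []) ([y] @ (xs @ rest) @ [])" by (rule reach_context)
  then show ?case using list_emb_Cons2 by auto
qed

text \<open>Moving one entry from the front to the back conjugates it by the product of the others, which is the
same as conjugating it by the product \<open>c\<close> of the whole tuple. The product of the tuple does not change, so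
the step can be repeated with the same \<open>c\<close>. With \<open>vs = []\<close> the whole tuple is conjugated by \<open>c\<close>.\<close>

lemma reach_rotate:
  assumes "set (us @ vs) \<subseteq> carrier G"
  shows "reach (us @ vs) (vs @ map (conj_by (tuple_prod (us @ vs))) us)"
  using assms
proof (induction us arbitrary: vs)
  case Nil
  then show ?case by (simp add: reach.base)
next
  case (Cons x us)
  define y where "y = conj_by (tuple_prod (us @ vs)) x"
  have c: "x \<in> carrier G" "set (us @ vs) \<subseteq> carrier G" using Cons.prems by auto
  have y: "y = conj_by (tuple_prod (x # us @ vs)) x"
  proof -
    have "conj_by (tuple_prod (x # us @ vs)) x = conj_by (tuple_prod (us @ vs)) (conj_by x x)"
      using c tuple_prod_closed[OF c(2)] by (simp only: tuple_prod_simps conj_by_mult)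
    moreover have "conj_by x x = x" using c by (simp add: conj_by_def)
    ultimately show ?thesis by (simp only: y_def)
  qed
  have "y \<in> carrier G"
    unfolding y_def using c tuple_prod_closed[OF c(2)] by (intro conj_by_closed)
  then have "reach (us @ (vs @ [y])) ((vs @ [y]) @ map (conj_by (tuple_prod (us @ (vs @ [y])))) us)"
    using c by (intro Cons.IH) auto
  moreover have "tuple_prod (us @ (vs @ [y])) = tuple_prod (x # us @ vs)"
  proof -
    have "tuple_prod (us @ (vs @ [y])) = tuple_prod (us @ vs) \<otimes> y"
      using c \<open>y \<in> carrier G\<close> tuple_prod_append[of "us @ vs" "[y]"] by simp
    also have "\<dots> = tuple_prod (x # us @ vs)"
      unfolding y_def conj_by_def tuple_prod_simps using c(1) tuple_prod_closed[OF c(2)]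
      by (simp add: m_assoc inv_cancel del: tuple_prod_closed)
    finally show ?thesis .
  qed
  moreover have "reach (x # us @ vs) ((us @ vs) @ [y])"
    unfolding y_def using c by (intro reach_past) auto
  ultimately show ?case by (auto simp: y intro: reach_trans)
qed

lemma reach_conj_pow:
  assumes us: "set us \<subseteq> carrier G"
  shows "reach us (map (conj_by (tuple_prod us [^] (k::nat))) us)"
proof (induction k)
  case 0
  have "map (conj_by \<one>) us = us" using us by (intro map_idI) auto
  then show ?case by (simp add: reach.base)
next
  case (Suc k)
  let ?c = "tuple_prod us"
  let ?us = "map (conj_by (?c [^] k)) us"
  have c: "?c \<in> carrier G" using us by simp
  have "tuple_prod ?us = conj_by (?c [^] k) ?c" using us c by (simp add: tuple_prod_map_conj)
  also have "\<dots> = ?c"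
  proof -
    have "?c \<otimes> ?c [^] k = ?c [^] k \<otimes> ?c"
      using nat_pow_Suc2[OF c, of k] by simp
    then have "conj_by (?c [^] k) ?c = inv (?c [^] k) \<otimes> (?c [^] k \<otimes> ?c)"
      using c by (simp add: conj_by_def m_assoc del: tuple_prod_closed)
    also have "\<dots> = ?c" using c by (intro inv_cancel) auto
    finally show ?thesis .
  qed
  finally have p: "tuple_prod ?us = ?c" .
  have "conj_by (?c [^] k) x \<in> carrier G" if "x \<in> set us" for x
    using that us c by (intro conj_by_closed nat_pow_closed) auto
  then have "set ?us \<subseteq> carrier G" by auto
  then have "reach ?us (map (conj_by ?c) ?us)"
    using reach_rotate[of ?us "[]"] p by simp
  moreover have "map (conj_by ?c) ?us = map (conj_by (?c [^] Suc k)) us"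
    using subsetD[OF us] c by (auto simp: conj_by_mult)
  ultimately show ?case using Suc reach_trans by metis
qed

lemma reach_hurwitz_word:
  assumes "reach s t" "s \<in> tuples G n"
  shows "\<exists>w\<in>braid_words n. t = hurwitz_word G w s"
  using assms
proof (induction rule: reach.induct)
  case (base s)
  then show ?case by (intro bexI[of _ "[]"]) (auto simp: hurwitz_word_def braid_words_def)
next
  case (move s p a b q)
  then obtain w where w: "w \<in> braid_words n" "p @ a # b # q = hurwitz_word G w s" by auto
  have "length (p @ a # b # q) = n"
    using hurwitz_word_tuples[OF w(1) move.prems] by (simp add: w(2) tuples_def)
  then have "(Suc (length p), True) # w \<in> braid_words n" using w(1) by (auto simp: braid_words_def)
  moreover have "hurwitz_word G ((Suc (length p), True) # w) s = p @ b # conj_by b a # q"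
    by (simp add: hurwitz_word_def w(2)[unfolded hurwitz_word_def, symmetric] conj_by_def
        nth_append list_update_append)
  ultimately show ?case by metis
qed

lemma finite_reach:
  assumes s: "s \<in> tuples G n"
    and fin: "finite (orbit (braid_group n) (hurwitz_action G n) s)"
  shows "finite {t. reach s t}"
proof -
  have "{t. reach s t} \<subseteq> orbit (braid_group n) (hurwitz_action G n) s"
  proof
    fix t assume "t \<in> {t. reach s t}"
    then obtain w where w: "w \<in> braid_words n" "t = hurwitz_word G w s"
      using reach_hurwitz_word s by blast
    then have "t = hurwitz_action G n (braid_class n w) s"
      using s by (simp add: hurwitz_action_class)
    then show "t \<in> orbit (braid_group n) (hurwitz_action G n) s"
      using w by (auto simp: orbit_def carrier_braid_group)
  qed
  then show ?thesis using fin finite_subset by blast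
qed

text \<open>The tuples obtained by conjugating the subtuple with powers of its product cannot all be different.\<close>

lemma subtuple_prod_pow_commutes:
  assumes s: "s \<in> tuples G n"
    and fin: "finite (orbit (braid_group n) (hurwitz_action G n) s)"
    and sub: "subseq us s"
  obtains m :: nat where "m > 0"
    "\<And>x. x \<in> set us \<Longrightarrow> tuple_prod us [^] m \<otimes> x = x \<otimes> tuple_prod us [^] m"
proof -
  have cs: "set s \<subseteq> carrier G" using s by (auto simp: tuples_def)
  obtain rest where rest: "reach s (us @ rest)" using reach_subseq[OF sub cs] by blast
  then have us: "set us \<subseteq> carrier G" using reach_closed[OF _ cs] by fastforce
  let ?c = "tuple_prod us"
  have c: "?c \<in> carrier G" using us by simp
  define F where "F = (\<lambda>k::nat. map (conj_by (?c [^] k)) us @ rest)"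
  have "range F \<subseteq> {t. reach s t}"
  proof -
    have "reach s (F k)" for k
      using reach_context[OF reach_conj_pow[OF us, of k], of "[]" rest] rest
      by (auto simp: F_def intro: reach_trans)
    then show ?thesis by auto
  qed
  then have "finite (range F)" using finite_reach[OF s fin] finite_subset by blast
  then have "\<not> inj F" using finite_imageD infinite_UNIV_nat by blast
  then obtain k l where kl: "k < l" "F k = F l"
    using linorder_injI[of F] by blast
  show ?thesis
  proof (rule that[of "l - k"])
    fix x assume x: "x \<in> set us"
    then have xc: "x \<in> carrier G" using us by auto
    let ?d = "?c [^] (l - k)"
    have d: "?d \<in> carrier G" "?c [^] k \<in> carrier G" using c by auto
    have "?c [^] l = ?d \<otimes> ?c [^] k" using kl(1) c by (simp add: nat_pow_mult)
    moreover have "conj_by (?c [^] k) x = conj_by (?c [^] l) x"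
      using kl(2) x by (auto simp: F_def)
    ultimately have "conj_by (?c [^] k) x = conj_by (?c [^] k) (conj_by ?d x)"
      using d xc by (simp add: conj_by_mult)
    then have "x = conj_by ?d x" using conj_by_inject[OF d(2) xc] d xc by simp
    then have "?d \<otimes> x = ?d \<otimes> conj_by ?d x" by simp
    also have "\<dots> = x \<otimes> ?d" using d xc by (simp add: conj_by_def m_assoc inv_cancel)
    finally show "?d \<otimes> x = x \<otimes> ?d" .
  qed (use kl in simp)
qed

end

section \<open>Finiteness of the reflection group\<close>

lemma GL_simps:
  "\<one>\<^bsub>GL\<^esub> = id" "f \<otimes>\<^bsub>GL\<^esub> g = f \<circ> g" "f \<in> carrier GL \<longleftrightarrow> linear f \<and> bij f"
  by (simp_all add: GL_def)

lemma GL_pow: "(f :: 'a::euclidean_space \<Rightarrow> 'a) [^]\<^bsub>GL\<^esub> (k::nat) = f ^^ k"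
proof -
  interpret group "GL :: ('a \<Rightarrow> 'a) monoid" by (rule group_GL)
  show ?thesis
    by (induction k) (simp_all add: GL_simps nat_pow_0 nat_pow_Suc funpow_Suc_right del: funpow.simps(2))
qed

text \<open>A real eigenvalue of an element of finite order is \<open>1\<close> or \<open>-1\<close>.\<close>

lemma coroot_root_eq_2:
  assumes s: "reflection s" and r: "root_coroot s r rv"
  shows "rv r = 2"
proof -
  obtain k where k: "k > 0" "s ^^ k = id"
    using s by (auto simp: reflection_def GL_pow GL_simps)
  have "linear s" using s by (simp add: reflection_def GL_simps)
  obtain \<zeta> v where z: "\<zeta> \<noteq> 1" "v \<noteq> 0" "s v = \<zeta> *\<^sub>R v" "rv r = 1 - \<zeta>"
    using r by (auto simp: root_coroot_def)
  have "(s ^^ j) v = (\<zeta> ^ j) *\<^sub>R v" for j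
    by (induction j) (simp_all add: z(3) linear_scale[OF \<open>linear s\<close>] mult.commute)
  from this[of k] have "\<zeta> ^ k = 1" using k z(2) by (metis id_apply scaleR_cancel_right scaleR_one)
  then have "\<bar>\<zeta>\<bar> ^ k = 1" by (simp flip: power_abs)
  then have "\<bar>\<zeta>\<bar> = 1" using k(1) power_eq_imp_eq_base[of "\<bar>\<zeta>\<bar>" k 1] by simp
  then show ?thesis using z by auto
qed

lemma invertible_mat_kernel:
  fixes C :: "real mat"
  assumes C: "C = Matrix.mat n n (\<lambda>(i, j). A i j)" and inv: "invertible_mat C"
    and ker: "\<And>i. i < n \<Longrightarrow> (\<Sum>j<n. A i j * x j) = 0" and j: "j < n"
  shows "x j = 0"
proof -
  have Cc: "C \<in> carrier_mat n n" unfolding C by simp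
  obtain D where D: "inverts_mat C D" "inverts_mat D C"
    using inv by (auto simp: invertible_mat_def)
  have DC: "D * C = 1\<^sub>m (dim_row D)" and CD: "C * D = 1\<^sub>m n"
    using D Cc by (simp_all add: inverts_mat_def)
  have "dim_col D = n" using arg_cong[OF CD, of dim_col] by simp
  moreover have "dim_row D = n" using arg_cong[OF DC, of dim_col] Cc by simp
  ultimately have Dc: "D \<in> carrier_mat n n" by (rule carrier_matI[rotated])
  define v where "v = Matrix.vec n x"
  have "C *\<^sub>v v = 0\<^sub>v n"
    by (intro eq_vecI) (simp_all add: C v_def scalar_prod_def ker atLeast0LessThan)
  then have "D *\<^sub>v (C *\<^sub>v v) = 0\<^sub>v n"
    using Dc by (auto intro!: eq_vecI simp: scalar_prod_def)
  moreover have "D *\<^sub>v (C *\<^sub>v v) = (D * C) *\<^sub>v v"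
    using Dc Cc by (intro assoc_mult_mat_vec[symmetric]) (auto simp: v_def)
  moreover have "(D * C) *\<^sub>v v = v" using DC Dc by (simp add: v_def)
  ultimately have "v = 0\<^sub>v n" by simp
  then have "vec_index v j = vec_index (0\<^sub>v n) j" by simp
  then show ?thesis using j by (simp add: v_def)
qed

text \<open>The hypothesis \<open>nondeg\<close> expresses that the Cartan matrix is invertible. It makes the roots a basis and
the coroots separate points.\<close>

locale euclidean_reflections =
  fixes n :: nat and s :: "('a::euclidean_space \<Rightarrow> 'a) list"
    and r :: "nat \<Rightarrow> 'a" and f :: "nat \<Rightarrow> 'a \<Rightarrow> real"
  assumes length: "length s = n" and dim: "DIM('a) = n"
    and GL: "set s \<subseteq> carrier GL"
    and linear: "\<And>i. i < n \<Longrightarrow> linear (f i)"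
    and s: "\<And>i x. i < n \<Longrightarrow> (s ! i) x = x - f i x *\<^sub>R r i"
    and cartan_sym: "\<And>i j. i < n \<Longrightarrow> j < n \<Longrightarrow> f i (r j) = f j (r i)"
    and two: "\<And>i. i < n \<Longrightarrow> f i (r i) = 2"
    and nondeg: "\<And>x j. (\<And>i. i < n \<Longrightarrow> (\<Sum>k<n. f i (r k) * x k) = 0) \<Longrightarrow> j < n \<Longrightarrow> x j = 0"
    and fin: "finite (orbit (braid_group n) (hurwitz_action GL n) s)"
begin

definition A :: "nat \<Rightarrow> nat \<Rightarrow> real" where "A i j = f i (r j)"

text \<open>The vector with given coordinates in the basis of roots. Words act on coordinates by \<open>act\<close> and on
vectors by \<open>g\<close>.\<close>

definition V :: "(nat \<Rightarrow> real) \<Rightarrow> 'a" where "V x = (\<Sum>k<n. x k *\<^sub>R r k)"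

definition g :: "nat list \<Rightarrow> 'a \<Rightarrow> 'a" where "g w = foldr (\<lambda>i. (\<circ>) (s ! i)) w id"

interpretation gl: group "GL :: ('a \<Rightarrow> 'a) monoid" by (rule group_GL)

lemma g_simps [simp]: "g [] = id" "g (i # w) = s ! i \<circ> g w" "g (v @ w) = g v \<circ> g w"
proof -
  show *: "g [] = id" "g (i # w) = s ! i \<circ> g w" for i w by (simp_all add: g_def)
  show "g (v @ w) = g v \<circ> g w" by (induction v) (simp_all add: * comp_assoc)
qed

lemma s_GL: "i < n \<Longrightarrow> s ! i \<in> carrier GL"
  using GL length by auto

lemma linear_g: "set w \<subseteq> {..<n} \<Longrightarrow> linear (g w)"
  using s_GL by (induction w) (auto simp: GL_simps linear_id intro: linear_compose)

lemma f_V: "i < n \<Longrightarrow> f i (V x) = (\<Sum>k<n. A i k * x k)"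
  by (simp add: V_def A_def linear_sum linear linear_scale mult.commute)

lemma V_unitv: "j < n \<Longrightarrow> V (unitv j) = r j"
  by (simp add: V_def unitv_def if_distrib[of "\<lambda>c. c *\<^sub>R _"] cong: if_cong)

lemma s_V: "i < n \<Longrightarrow> (s ! i) (V x) = V (coord_refl n A i x)"
proof -
  assume i: "i < n"
  have "V (coord_refl n A i x) = (\<Sum>k<n. x k *\<^sub>R r k - (if k = i then f i (V x) *\<^sub>R r k else 0))"
    unfolding V_def[of "coord_refl n A i x"]
    by (intro sum.cong) (auto simp: coord_refl_def f_V[OF i] scaleR_left_diff_distrib)
  also have "\<dots> = (s ! i) (V x)" using i by (simp add: s sum_subtractf V_def)
  finally show ?thesis ..
qed

lemma g_V: "set w \<subseteq> {..<n} \<Longrightarrow> g w (V x) = V (act n A w x)"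
  by (induction w) (simp_all add: s_V)

lemma V_inj: "V x = V y \<Longrightarrow> k < n \<Longrightarrow> x k = y k"
proof -
  assume eq: "V x = V y" and k: "k < n"
  have "(\<Sum>k<n. f i (r k) * (x k - y k)) = 0" if "i < n" for i
    using arg_cong[OF eq, of "f i"] that
    by (simp add: f_V A_def algebra_simps sum_subtractf)
  then have "x k - y k = 0" using k by (rule nondeg)
  then show ?thesis by simp
qed

lemma V_surj: "\<exists>x. y = V x"
proof -
  have inj: "inj_on r {..<n}"
  proof (rule inj_onI)
    fix i j assume ij: "i \<in> {..<n}" "j \<in> {..<n}" "r i = r j"
    then have "V (unitv i) = V (unitv j)" by (simp add: V_unitv)
    then have "unitv i i = (unitv j i :: real)" using ij by (intro V_inj) auto
    then show "i = j" by (auto simp: unitv_def split: if_splits)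
  qed
  have "independent (r ` {..<n})"
    unfolding dependent_finite[OF finite_imageI[OF finite_lessThan]]
  proof (intro notI, elim exE conjE bexE)
    fix u v assume uv: "v \<in> r ` {..<n}" "u v \<noteq> 0" "(\<Sum>v\<in>r ` {..<n}. u v *\<^sub>R v) = 0"
    then obtain k where k: "k < n" "v = r k" by auto
    have "V (u \<circ> r) = V (\<lambda>_. 0)" using uv(3) by (simp add: sum.reindex[OF inj] V_def)
    from V_inj[OF this k(1)] show False using uv(2) k(2) by simp
  qed
  moreover have "card (r ` {..<n}) = DIM('a)" using inj by (simp add: card_image dim)
  ultimately have "span (r ` {..<n}) = UNIV"
    using card_ge_dim_independent[of "r ` {..<n}" UNIV] by (auto simp: dim_UNIV)
  then have "y \<in> span (r ` {..<n})" by simp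
  then obtain u where "y = (\<Sum>v\<in>r ` {..<n}. u v *\<^sub>R v)" by (auto simp: span_finite)
  also have "\<dots> = V (u \<circ> r)" by (simp add: sum.reindex[OF inj] V_def)
  finally show ?thesis by blast
qed

lemma word_eq_act:
  assumes "g v = g w" "set v \<subseteq> {..<n}" "set w \<subseteq> {..<n}"
  shows "act n A v x = act n A w x"
proof
  fix k
  show "act n A v x k = act n A w x k"
  proof (cases "k < n")
    case True
    have "V (act n A v x) = V (act n A w x)" using assms by (simp flip: g_V)
    then show ?thesis using True by (rule V_inj)
  next
    case False
    then have "k \<notin> set v" "k \<notin> set w" using assms by auto
    then show ?thesis by (simp add: act_outside)
  qed
qed

lemma commuting_power:
  assumes I: "I \<subseteq> {..<n}"
  shows "\<exists>m>0. \<forall>i\<in>I. g (concat (replicate m (sorted_list_of_set I)) @ [i]) =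
    g (i # concat (replicate m (sorted_list_of_set I)))"
proof -
  let ?w = "sorted_list_of_set I"
  have finI: "finite I" using I finite_subset by blast
  have "?w = filter (\<lambda>i. i \<in> I) [0..<n]"
    using I by (intro sorted_distinct_set_unique) (auto simp: finI sorted_wrt_filter)
  then have "subseq (map ((!) s) ?w) (map ((!) s) [0..<n])"
    by (metis subseq_map subseq_filter_left)
  then have sub: "subseq (map ((!) s) ?w) s" using length map_nth[of s] by simp
  have st: "s \<in> tuples GL n" using GL length by (simp add: tuples_def)
  obtain m :: nat where m: "m > 0" "\<And>x. x \<in> set (map ((!) s) ?w) \<Longrightarrow>
      gl.tuple_prod (map ((!) s) ?w) [^]\<^bsub>GL\<^esub> m \<otimes>\<^bsub>GL\<^esub> x = x \<otimes>\<^bsub>GL\<^esub> gl.tuple_prod (map ((!) s) ?w) [^]\<^bsub>GL\<^esub> m"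
    using gl.subtuple_prod_pow_commutes[OF st fin sub] by blast
  have "gl.tuple_prod (map ((!) s) w) = g w" for w
    by (induction w) (simp_all add: GL_simps)
  moreover have "g (concat (replicate k w)) = g w ^^ k" for k w
    by (induction k) simp_all
  ultimately show ?thesis using m finI by (auto simp: GL_pow GL_simps)
qed

sublocale torsion_cartan n A
proof
  show "A i j = A j i" if "i < n" "j < n" for i j
    using cartan_sym[OF that] by (simp add: A_def)
  show "A i i = 2" if "i < n" for i
    using two[OF that] by (simp add: A_def)
  fix I assume I: "I \<subseteq> {..<n}"
  then have finI: "finite I" using finite_subset by blast
  obtain m where m: "m > 0" "\<forall>i\<in>I. g (concat (replicate m (sorted_list_of_set I)) @ [i]) =
    g (i # concat (replicate m (sorted_list_of_set I)))"
    using commuting_power[OF I] by blast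
  have "act n A (concat (replicate m (sorted_list_of_set I)) @ [i]) (unitv i) =
    act n A (i # concat (replicate m (sorted_list_of_set I))) (unitv i)" if "i \<in> I" for i
    using m(2) that I finI by (intro word_eq_act) auto
  then show "\<exists>m>0. \<forall>i\<in>I. act n A (concat (replicate m (sorted_list_of_set I)) @ [i]) (unitv i) =
    act n A (i # concat (replicate m (sorted_list_of_set I))) (unitv i)"
    using m(1) by blast
qed

text \<open>Inverses of generators are words because the generators are involutions.\<close>

lemma generate_words: "generate GL (set s) \<subseteq> g ` {w. set w \<subseteq> {..<n}}"
proof
  fix h assume "h \<in> generate GL (set s)"
  then have "\<exists>w. set w \<subseteq> {..<n} \<and> h = g w"
  proof (induction rule: generate.induct)
    case one
    then show ?case by (intro exI[of _ "[]"]) (simp add: GL_simps)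
  next
    case (incl h)
    then obtain i where "i < n" "h = s ! i" using length by (metis in_set_conv_nth)
    then show ?case by (intro exI[of _ "[i]"]) simp
  next
    case (inv h)
    then obtain i where i: "i < n" "h = s ! i" using length by (metis in_set_conv_nth)
    have "(s ! i) ((s ! i) x) = x" for x
      using i linear[OF i(1)] by (simp add: s two linear_diff linear_scale)
    then have "h \<otimes>\<^bsub>GL\<^esub> h = \<one>\<^bsub>GL\<^esub>" by (simp add: GL_simps i fun_eq_iff)
    then have "inv\<^bsub>GL\<^esub> h = h" using s_GL i by (intro gl.inv_equality) auto
    then show ?case using i by (intro exI[of _ "[i]"]) simp
  next
    case (eng h1 h2)
    then obtain v w where "set v \<subseteq> {..<n}" "h1 = g v" "set w \<subseteq> {..<n}" "h2 = g w" by blast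
    then show ?case by (intro exI[of _ "v @ w"]) (simp add: GL_simps)
  qed
  then show "h \<in> g ` {w. set w \<subseteq> {..<n}}" by blast
qed

text \<open>Roots span and coroots separate points.\<close>

lemma linear_eq_by_coefficients:
  assumes h: "linear h" "linear h'"
    and eq: "\<And>i j. i < n \<Longrightarrow> j < n \<Longrightarrow> f i (h (r j)) = f i (h' (r j))"
  shows "h = h'"
proof
  have *: "h (r j) = h' (r j)" if j: "j < n" for j
  proof -
    obtain x where x: "h (r j) = V x" using V_surj by blast
    obtain x' where x': "h' (r j) = V x'" using V_surj by blast
    have "(\<Sum>k<n. f i (r k) * (x k - x' k)) = 0" if "i < n" for i
      using eq[OF that j] that by (simp add: x x' f_V A_def algebra_simps sum_subtractf)
    then have "x k - x' k = 0" if "k < n" for k using that by (rule nondeg)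
    then have "V x = V x'" unfolding V_def by (intro sum.cong) auto
    then show ?thesis using x x' by simp
  qed
  fix y
  obtain x where "y = V x" using V_surj by blast
  then show "h y = h' y" using h by (simp add: V_def linear_sum linear_scale *)
qed

lemma finite_generate: "finite (generate GL (set s))"
proof -
  let ?S = "{B (e i) (act n A w (e j)) |i j w. i < n \<and> j < n \<and> set w \<subseteq> {..<n}}"
  let ?W = "{w. set w \<subseteq> {..<n}}"
  let ?I = "{..<n} \<times> {..<n}"
  define coeffs where "coeffs = (\<lambda>h::'a \<Rightarrow> 'a. restrict (\<lambda>(i, j). f i (h (r j))) ?I)"
  have "inj_on coeffs (g ` ?W)"
  proof (rule inj_onI)
    fix h h' assume hh: "h \<in> g ` ?W" "h' \<in> g ` ?W" and eq: "coeffs h = coeffs h'"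
    have "f i (h (r j)) = f i (h' (r j))" if "i < n" "j < n" for i j
      using fun_cong[OF eq, of "(i, j)"] that by (simp add: coeffs_def)
    then show "h = h'" using hh by (intro linear_eq_by_coefficients) (auto simp: linear_g)
  qed
  moreover have "coeffs ` (g ` ?W) \<subseteq> (\<Pi>\<^sub>E _\<in>?I. ?S)"
  proof -
    have "f i (g w (r j)) \<in> ?S" if "i < n" "j < n" "set w \<subseteq> {..<n}" for i j w
    proof -
      have "f i (g w (r j)) = B (e i) (act n A w (e j))"
        using that by (simp add: f_V g_V bil_unitv flip: V_unitv)
      then show ?thesis using that by blast
    qed
    then show ?thesis unfolding coeffs_def by (intro image_subsetI) auto
  qed
  moreover have "finite (\<Pi>\<^sub>E _\<in>?I. ?S)"
    using finite_matrix_coefficients by (intro finite_PiE) auto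
  ultimately have "finite (g ` ?W)" using inj_on_finite by blast
  then show ?thesis using generate_words finite_subset by blast
qed

end

theorem mainTheorem1:
  fixes s :: "(real ^ 'n \<Rightarrow> real ^ 'n) list"
  assumes "length s = CARD('n)"
    and "\<forall>t\<in>set s. reflection t"
    and "\<exists>C. cartan_matrix s C \<and> transpose_mat C = C \<and> invertible_mat C"
    and "finite (orbit (braid_group CARD('n)) (hurwitz_action GL CARD('n)) s)"
  shows "finite (generate GL (set s))"
proof -
  let ?n = "CARD('n)"
  obtain C r rv where rr: "\<forall>i<?n. root_coroot (s ! i) (r ! i) (rv ! i)"
    and C: "C = Matrix.mat ?n ?n (\<lambda>(i, j). (rv ! i) (r ! j))"
    and C_sym: "transpose_mat C = C" and C_inv: "invertible_mat C"
    using assms(1,3) by (auto simp: cartan_matrix_def)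
  have refl: "reflection (s ! i)" if "i < ?n" for i
    using assms(1,2) that by simp
  have "euclidean_reflections ?n s ((!) r) ((!) rv)"
  proof (rule euclidean_reflections.intro)
    show "length s = ?n" by (rule assms(1))
    show "DIM(real ^ 'n) = ?n" by simp
    show "set s \<subseteq> carrier GL" using assms(2) by (auto simp: reflection_def)
    show "linear (rv ! i)" if "i < ?n" for i
      using rr that by (auto simp: root_coroot_def)
    show "(s ! i) x = x - (rv ! i) x *\<^sub>R r ! i" if "i < ?n" for i x
      using rr that by (auto simp: root_coroot_def)
    show "(rv ! i) (r ! j) = (rv ! j) (r ! i)" if "i < ?n" "j < ?n" for i j
    proof -
      have "transpose_mat C $$ (j, i) = C $$ (j, i)" by (simp only: C_sym)
      then show ?thesis using that by (simp add: C)
    qed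
    show "(rv ! i) (r ! i) = 2" if "i < ?n" for i
      using coroot_root_eq_2 refl[OF that] rr that by blast
    show "x j = 0" if "\<And>i. i < ?n \<Longrightarrow> (\<Sum>k<?n. (rv ! i) (r ! k) * x k) = 0" "j < ?n" for x j
      using C C_inv that by (rule invertible_mat_kernel)
    show "finite (orbit (braid_group ?n) (hurwitz_action GL ?n) s)" by (rule assms(4))
  qed
  then show ?thesis by (rule euclidean_reflections.finite_generate)
qed

end
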